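(* There is an absolute constant $c>0$ such that the following holds. Let $r\ge2$ and $\delta>0$, and let $P_1,\dots,P_n\colon\mathbb{F}_2^m\to\mathbb{F}_2$ be polynomials of degree at most $3$ such that $\operatorname{rank}_2(P_i)\le r\le\sqrt{\log\log n}$ and $|\Pr_X[P_i(X)=1]-1/3|\ge\delta$ for all $i\in[n]$. Let $\mathcal{P}$ be the distribution of $(P_1(X),\dots,P_n(X))$ for $X$ uniform on $\mathbb{F}_2^m$. Then \[ \|\mathcal{P}-\mathrm{Ber}(1/3)^{\otimes n}\|_{\mathtt{TV}}\ \ge\ 1-\frac{2^{-(\log n)^{c/r^2}}}{\delta^2}. \]
   Context: Logarithms are base 2. For $P$ not identically zero, $\operatorname{rank}_2(P)$ is the smallest positive integer $k$ such that $P=\Gamma(Q_1,\dots,Q_k)$ for some polynomials $Q_j$ of degree at most $2$ and some $\Gamma\colon\mathbb{F}_2^k\to\mathbb{F}_2$. Total variation distance: $\frac12\sum_x|\mathcal{D}_1(x)-\mathcal{D}_2(x)|$. *)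

theory Defs
  imports Complex_Main
begin

text \<open>F_2 is modelled by bool (addition = xor, multiplication = conjunction).
  Points of F_2^m are functions nat => bool vanishing outside {0..<m}.\<close>

definition cube :: "nat \<Rightarrow> (nat \<Rightarrow> bool) set" where
  "cube m = {x. \<forall>i. m \<le> i \<longrightarrow> \<not> x i}"

text \<open>f : F_2^m -> F_2 is (the function of) a polynomial of degree at most d:
  f is an F_2-sum of monomials prod_{i in S} x_i with S a subset of {0..<m}, |S| <= d.\<close>

definition poly_deg_le :: "nat \<Rightarrow> nat \<Rightarrow> ((nat \<Rightarrow> bool) \<Rightarrow> bool) \<Rightarrow> bool" where
  "poly_deg_le m d f \<longleftrightarrow>
     (\<exists>C. C \<subseteq> {S. S \<subseteq> {..<m} \<and> card S \<le> d} \<and>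
          (\<forall>x\<in>cube m. f x = odd (card {S\<in>C. \<forall>i\<in>S. x i})))"

definition rank2 :: "nat \<Rightarrow> ((nat \<Rightarrow> bool) \<Rightarrow> bool) \<Rightarrow> nat" where
  "rank2 m P = (LEAST k. 0 < k \<and>
     (\<exists>(Q :: nat \<Rightarrow> (nat \<Rightarrow> bool) \<Rightarrow> bool) (\<Gamma> :: (nat \<Rightarrow> bool) \<Rightarrow> bool).
        (\<forall>j<k. poly_deg_le m 2 (Q j)) \<and>
        (\<forall>x\<in>cube m. P x = \<Gamma> (\<lambda>j. if j < k then Q j x else False))))"

definition prob_one :: "nat \<Rightarrow> ((nat \<Rightarrow> bool) \<Rightarrow> bool) \<Rightarrow> real" where
  "prob_one m f = real (card {x\<in>cube m. f x}) / 2 ^ m"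

definition distP :: "nat \<Rightarrow> nat \<Rightarrow> (nat \<Rightarrow> (nat \<Rightarrow> bool) \<Rightarrow> bool) \<Rightarrow> (nat \<Rightarrow> bool) \<Rightarrow> real" where
  "distP m n P y = real (card {x\<in>cube m. \<forall>i<n. P i x = y i}) / 2 ^ m"

definition ber_prod :: "nat \<Rightarrow> real \<Rightarrow> (nat \<Rightarrow> bool) \<Rightarrow> real" where
  "ber_prod n p y = p ^ card {i. i < n \<and> y i} * (1 - p) ^ (n - card {i. i < n \<and> y i})"

definition tv_dist :: "nat \<Rightarrow> ((nat \<Rightarrow> bool) \<Rightarrow> real) \<Rightarrow> ((nat \<Rightarrow> bool) \<Rightarrow> real) \<Rightarrow> real" where
  "tv_dist n D1 D2 = (1/2) * (\<Sum>y\<in>cube n. \<bar>D1 y - D2 y\<bar>)"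

end

theory Submission
  imports Defs "HOL-Library.Function_Algebras"
begin

text \<open>
  Write every function of bounded rank through the signs of at most r quadratics. A product of such
  signs either has small correlation with every character, or its polar form has a large radical,
  in which case it is a function of few characters.

  Among the n coordinates one therefore finds many indices i for which the quadratics consist of a
  common core and a private part, such that no nontrivial word in the core and in the private parts
  of two indices has low rank: as long as many indices violate this, a pigeonhole argument replaces
  a private quadratic by a word in the core, enlarged by one common element, up to few characters.
  The rank threshold grows by a factor O(r) with each of the at most 2r replacements. The
  same elimination, applied to the characters that have been split off, makes these independent.

  Let M be the part of the Fourier expansion of P i that is supported on core words. It is a dyadic
  rational with bounded denominator, so it stays away from 1/3, while the remainders P i - M are
  pairwise almost orthogonal, even after multiplication by functions of the core. Hence the
  statistic that sums (M - 1/3) (y i - 1/3) over the selected indices is large on the samples of P,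
  and by Chebyshev and a union bound over the values of the core it is small under the Bernoulli
  measure.
\<close>

section \<open>The Boolean cube and its characters\<close>

text \<open>The coordinates may share quadratics, so they need not be close to pairwise independent;
  the shared words must be isolated before any variance estimate. The rank threshold cannot be fixed
  in advance: solving a relation of rank \<tau> for a generator leaves a factor determined by \<tau>
  characters, to be split off. With \<open>r * \<sigma>\<close> such characters per index,
  coefficient sums and the union bound cost \<open>2 ^ O(r * \<sigma>)\<close>, which a bias of
  about \<open>2 ^ (- rank / 2)\<close> must beat. So the threshold is tied to the accumulated error
  as \<open>100 * r * \<sigma>\<close>. There are two stages because a nontrivial character has mean
  exactly 0, whereas a quadratic only has small bias, and only at high rank. That bias bound is
  uniform over all characters, which keeps the first stage valid after the second. With
  \<open>D\<close> bounding the final \<open>r * \<sigma>\<close>, the pigeonhole steps need at most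
  \<open>2 ^ (474 * r * D^2)\<close> indices. Starting from \<sigma> near
  \<open>(log n) powr (1 / 8)\<close>, this is at most n for large n, since
  \<open>r \<le> sqrt (log log n)\<close> keeps the factors depending on r below
  \<open>(log n) powr (3 / 4)\<close>.\<close>

definition cadd :: "(nat \<Rightarrow> bool) \<Rightarrow> (nat \<Rightarrow> bool) \<Rightarrow> nat \<Rightarrow> bool" where
  "cadd x y = (\<lambda>i. x i \<noteq> y i)"

abbreviation czero :: "nat \<Rightarrow> bool" where "czero \<equiv> (\<lambda>_. False)"

lemma cadd_assoc: "cadd (cadd x y) z = cadd x (cadd y z)"
  by (auto simp: cadd_def)

lemma cadd_commute: "cadd x y = cadd y x"
  by (auto simp: cadd_def)

lemma cadd_left_commute: "cadd x (cadd y z) = cadd y (cadd x z)"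
  by (auto simp: cadd_def)

lemma cadd_self [simp]: "cadd x x = czero" and cadd_zero [simp]: "cadd x czero = x" "cadd czero x = x"
  and cadd_cancel [simp]: "cadd x (cadd x y) = y"
  by (auto simp: cadd_def)

lemma cadd_in_cube [simp]: "x \<in> cube m \<Longrightarrow> y \<in> cube m \<Longrightarrow> cadd x y \<in> cube m"
  and czero_in_cube [simp]: "czero \<in> cube m"
  by (auto simp: cube_def cadd_def)

lemma cube_Suc: "cube (Suc n) = cube n \<union> (\<lambda>y. y(n := True)) ` cube n"
proof (intro equalityI subsetI)
  fix x assume x: "x \<in> cube (Suc n)"
  show "x \<in> cube n \<union> (\<lambda>y. y(n := True)) ` cube n"
  proof (cases "x n")
    case True
    have "x(n := False) \<in> cube n"
      using x unfolding cube_def mem_Collect_eq by (metis Suc_leI fun_upd_apply le_eq_less_or_eq)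
    moreover have "x = (x(n := False))(n := True)" using True by (simp add: fun_upd_idem)
    ultimately show ?thesis by blast
  next
    case False
    with x have "x \<in> cube n" unfolding cube_def mem_Collect_eq by (metis Suc_leI le_eq_less_or_eq)
    then show ?thesis by blast
  qed
qed (auto simp: cube_def)

lemma cube_Suc_disjoint: "cube n \<inter> (\<lambda>y. y(n := True)) ` cube n = {}"
  by (auto simp: cube_def)

lemma inj_on_cube_upd: "inj_on (\<lambda>y. y(n := True)) (cube n)"
proof (rule inj_onI)
  fix x y assume xy: "x \<in> cube n" "y \<in> cube n" "x(n := True) = y(n := True)"
  show "x = y"
  proof
    fix i show "x i = y i"
      using xy(1,2) fun_cong[OF xy(3), of i] by (cases "i = n") (simp_all add: cube_def)
  qed
qed

lemma cube_0: "cube 0 = {czero}"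
  by (auto simp: cube_def)

lemma finite_cube [simp]: "finite (cube n)"
  by (induction n) (auto simp: cube_0 cube_Suc)

lemma card_cube: "card (cube n) = 2 ^ n"
  by (induction n)
     (simp_all add: cube_0 cube_Suc card_Un_disjoint cube_Suc_disjoint card_image inj_on_cube_upd)

lemma sum_cube_translate:
  assumes "h \<in> cube m"
  shows "(\<Sum>x\<in>cube m. f (cadd h x)) = (\<Sum>x\<in>cube m. f x)"
  by (rule sum.reindex_bij_witness[of _ "cadd h" "cadd h"]) (use assms in auto)

text \<open>Every vector is its own negative, so these are exactly the linear subspaces over
  F_2.\<close>

definition subgrp :: "nat \<Rightarrow> (nat \<Rightarrow> bool) set \<Rightarrow> bool" where
  "subgrp m U \<longleftrightarrow> U \<subseteq> cube m \<and> czero \<in> U \<and> (\<forall>x\<in>U. \<forall>y\<in>U. cadd x y \<in> U)"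

lemma subgrp_adjoin:
  assumes U: "subgrp m U" and v: "v \<in> cube m"
  shows "subgrp m (U \<union> cadd v ` U)"
proof -
  have "cadd (cadd v x) (cadd v y) = cadd x y" for x y
    by (auto simp: cadd_def)
  then show ?thesis
    using U v unfolding subgrp_def
    by (auto simp: cadd_assoc cadd_left_commute[of _ v] intro!: imageI)
qed

lemma card_adjoin:
  assumes U: "subgrp m U" and v: "v \<in> cube m" "v \<notin> U"
  shows "card (U \<union> cadd v ` U) = 2 * card U"
proof -
  have fin: "finite U" using U by (auto simp: subgrp_def intro: finite_subset)
  have disj: "U \<inter> cadd v ` U = {}"
  proof (rule ccontr)
    assume "U \<inter> cadd v ` U \<noteq> {}"
    then obtain x where x: "x \<in> U" "cadd v x \<in> U" by auto
    have "cadd (cadd v x) x = v" by (auto simp: cadd_def)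
    with x U v show False unfolding subgrp_def by metis
  qed
  have "inj_on (cadd v) U" by (rule inj_on_inverseI[of _ "cadd v"]) simp
  then show ?thesis using fin disj by (simp add: card_Un_disjoint card_image)
qed

text \<open>The characters \<open>(-1)^l\<close> with l linear. Fixing the value 1 off the cube
  turns nontriviality on the cube into the inequation \<open>g \<noteq> 1\<close>.\<close>

definition lin :: "nat \<Rightarrow> ((nat \<Rightarrow> bool) \<Rightarrow> real) set" where
  "lin m = {g. (\<forall>x\<in>cube m. g x = 1 \<or> g x = -1) \<and> (\<forall>x. x \<notin> cube m \<longrightarrow> g x = 1) \<and>
     (\<forall>x\<in>cube m. \<forall>y\<in>cube m. g (cadd x y) = g x * g y)}"

text \<open>Translation by v multiplies the sum by \<open>g v\<close>. The hypothesis is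
  multiplicativity on the cube, and not membership in \<open>lin m\<close>, so that the polar form
  of a quadratic qualifies too.\<close>

lemma character_sum:
  fixes g :: "(nat \<Rightarrow> bool) \<Rightarrow> real"
  assumes mult: "\<And>x y. x \<in> cube m \<Longrightarrow> y \<in> cube m \<Longrightarrow> g (cadd x y) = g x * g y"
    and v: "v \<in> cube m" "g v \<noteq> 1"
  shows "(\<Sum>x\<in>cube m. g x) = 0"
proof -
  have "(\<Sum>x\<in>cube m. g x) = (\<Sum>x\<in>cube m. g (cadd v x))"
    using sum_cube_translate[OF v(1), of g] by simp
  also have "\<dots> = g v * (\<Sum>x\<in>cube m. g x)"
    using mult v by (simp add: sum_distrib_left)
  finally show ?thesis using v by simp
qed

lemma lin_sum_eq_0:
  assumes g: "g \<in> lin m" "g \<noteq> 1"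
  shows "(\<Sum>x\<in>cube m. g x) = 0"
proof -
  obtain v where "g v \<noteq> 1" using g(2) by (auto simp: fun_eq_iff)
  then show ?thesis using g by (intro character_sum[of m g v]) (auto simp: lin_def)
qed

text \<open>A subspace \<open>W\<close> maximal among those containing \<open>U\<close> and avoiding
  v has index two: by maximality \<open>cadd v x \<in> W\<close> for each x outside
  \<open>W\<close>. The sign of membership in \<open>W\<close> is then a character.\<close>

lemma separating_character:
  assumes U: "subgrp m U" and v: "v \<in> cube m" "v \<notin> U"
  shows "\<exists>g\<in>lin m. (\<forall>x\<in>U. g x = 1) \<and> g v = -1"
proof -
  define F where "F = {W. subgrp m W \<and> U \<subseteq> W \<and> v \<notin> W}"
  have "finite F" by (rule finite_subset[of _ "Pow (cube m)"]) (auto simp: F_def subgrp_def)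
  moreover have "U \<in> F" using U v by (simp add: F_def)
  ultimately obtain W where W: "W \<in> F" and mx: "\<And>W'. W' \<in> F \<Longrightarrow> W \<subseteq> W' \<Longrightarrow> W' = W"
    by (metis finite_has_maximal2)
  have sW: "subgrp m W" "v \<notin> W" "U \<subseteq> W" using W by (auto simp: F_def)
  have W0: "czero \<in> W" using sW by (simp add: subgrp_def)
  have dich: "cadd v x \<in> W" if x: "x \<in> cube m" "x \<notin> W" for x
  proof (rule ccontr)
    assume nv: "cadd v x \<notin> W"
    have "x \<in> W \<union> cadd x ` W" using W0 by (auto intro!: image_eqI[of _ _ czero])
    then have "W \<union> cadd x ` W \<noteq> W" using x by auto
    then have "W \<union> cadd x ` W \<notin> F" using mx by blast
    then have "v \<in> cadd x ` W" using sW subgrp_adjoin[OF sW(1) x(1)] by (auto simp: F_def)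
    then obtain w where w: "w \<in> W" "v = cadd x w" by auto
    then have "cadd v x = w" by (auto simp: cadd_def)
    then show False using nv w by simp
  qed
  define g where "g = (\<lambda>x. if x \<in> cube m \<and> x \<notin> W then -1 else (1::real))"
  have Wadd: "cadd x y \<in> W" if "x \<in> W" "y \<in> W" for x y using sW that by (auto simp: subgrp_def)
  have mult: "g (cadd x y) = g x * g y" if xy: "x \<in> cube m" "y \<in> cube m" for x y
  proof -
    have e1: "cadd (cadd v x) (cadd v y) = cadd x y" and e2: "cadd (cadd x y) x = y"
      and e3: "cadd (cadd x y) y = x"
      by (auto simp: cadd_def)
    show ?thesis
    proof (cases "x \<in> W")
      case True
      then have "cadd x y \<in> W \<longleftrightarrow> y \<in> W" using Wadd e2 by metis
      then show ?thesis using xy True by (auto simp: g_def)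
    next
      case False
      have "cadd x y \<in> W \<longleftrightarrow> y \<notin> W"
        using False Wadd e1 e3 dich xy by metis
      then show ?thesis using xy False by (auto simp: g_def)
    qed
  qed
  have "g \<in> lin m" using mult by (auto simp: lin_def g_def)
  moreover have "\<forall>x\<in>U. g x = 1" "g v = -1" using sW v by (auto simp: g_def)
  ultimately show ?thesis by blast
qed

text \<open>Induction on the codimension bound s. Adjoining v doubles \<open>U\<close>; the s
  characters for the larger space leave only the coset of v to be removed, and one separating
  character does that.\<close>

lemma subgrp_cut_out:
  assumes "subgrp m U" "2 ^ m \<le> card U * 2 ^ s"
  shows "\<exists>\<Lambda>\<subseteq>lin m. finite \<Lambda> \<and> card \<Lambda> \<le> s \<and> {x\<in>cube m. \<forall>g\<in>\<Lambda>. g x = 1} \<subseteq> U"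
  using assms
proof (induction s arbitrary: U)
  case 0
  then have "U = cube m"
    by (intro card_subset_eq) (auto simp: subgrp_def card_cube intro!: antisym card_mono[of "cube m", unfolded card_cube])
  then show ?case by (intro exI[of _ "{}"]) auto
next
  case (Suc s)
  show ?case
  proof (cases "U = cube m")
    case True
    then show ?thesis by (intro exI[of _ "{}"]) auto
  next
    case False
    then obtain v where v: "v \<in> cube m" "v \<notin> U" using Suc.prems by (auto simp: subgrp_def)
    let ?U = "U \<union> cadd v ` U"
    obtain \<Lambda> where L: "\<Lambda> \<subseteq> lin m" "finite \<Lambda>" "card \<Lambda> \<le> s" "{x\<in>cube m. \<forall>g\<in>\<Lambda>. g x = 1} \<subseteq> ?U"
      using Suc.IH[of ?U] subgrp_adjoin[OF Suc.prems(1) v(1)] Suc.prems card_adjoin[OF Suc.prems(1) v]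
      by auto
    obtain g where g: "g \<in> lin m" "\<forall>x\<in>U. g x = 1" "g v = -1"
      using separating_character[OF Suc.prems(1) v] by blast
    have "{x\<in>cube m. \<forall>h\<in>insert g \<Lambda>. h x = 1} \<subseteq> U"
    proof
      fix x assume x: "x \<in> {x\<in>cube m. \<forall>h\<in>insert g \<Lambda>. h x = 1}"
      then have "x \<in> ?U" "g x = 1" using L by auto
      moreover have "g (cadd v u) = -1" if "u \<in> U" for u
      proof -
        have "u \<in> cube m" using that Suc.prems by (auto simp: subgrp_def)
        then have "g (cadd v u) = g v * g u" using g(1) v by (auto simp: lin_def)
        then show ?thesis using g that by auto
      qed
      ultimately show "x \<in> U" by auto
    qed
    moreover have "card (insert g \<Lambda>) \<le> Suc s" using L card_insert_le_m1 by (metis Suc_le_mono card_insert_if le_SucI L(2))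
    ultimately show ?thesis using L g by (intro exI[of _ "insert g \<Lambda>"]) auto
  qed
qed

section \<open>Quadratic sign functions\<close>

text \<open>Sign functions take the value 1 off the cube, so that \<open>g * g = 1\<close> holds as an equation of functions.\<close>

definition quad :: "nat \<Rightarrow> ((nat \<Rightarrow> bool) \<Rightarrow> real) set" where
  "quad m = {g. (\<forall>x\<in>cube m. g x = 1 \<or> g x = -1) \<and> (\<forall>x. x \<notin> cube m \<longrightarrow> g x = 1) \<and>
     (\<forall>x\<in>cube m. \<forall>y\<in>cube m. \<forall>z\<in>cube m.
        g (cadd x (cadd y z)) * g czero * (g x * g y * g z)
          = g (cadd x y) * g (cadd y z) * g (cadd x z))}"

definition determined :: "nat \<Rightarrow> ((nat \<Rightarrow> bool) \<Rightarrow> real) set \<Rightarrow> ((nat \<Rightarrow> bool) \<Rightarrow> 'a) \<Rightarrow> bool" where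
  "determined m X P \<longleftrightarrow>
     (\<forall>x\<in>cube m. \<forall>y\<in>cube m. (\<forall>g\<in>X. g x = g y) \<longrightarrow> P x = P y)"

text \<open>Rank is the number of characters that determine g, in place of the rank of the polar
  form: it is subadditive under products by taking unions, and it hands over directly the characters
  to be split off.\<close>

definition low_rank :: "nat \<Rightarrow> nat \<Rightarrow> ((nat \<Rightarrow> bool) \<Rightarrow> real) set" where
  "low_rank m \<rho> = {g. \<exists>\<Lambda>\<subseteq>lin m. finite \<Lambda> \<and> card \<Lambda> \<le> \<rho> \<and> determined m \<Lambda> g}"

lemma quad_sign: "g \<in> quad m \<Longrightarrow> g x = 1 \<or> g x = -1"
  by (auto simp: quad_def)

lemma lin_sign: "g \<in> lin m \<Longrightarrow> g x = 1 \<or> g x = -1"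
  by (auto simp: lin_def)

lemma lin_add: "g \<in> lin m \<Longrightarrow> x \<in> cube m \<Longrightarrow> y \<in> cube m \<Longrightarrow> g (cadd x y) = g x * g y"
  by (simp add: lin_def)

lemma lin_zero: "g \<in> lin m \<Longrightarrow> g czero = 1"
  using lin_add[of g m czero czero] lin_sign[of g m czero] by auto

lemma one_in_quad: "1 \<in> quad m" and one_in_lin: "1 \<in> lin m"
  by (auto simp: quad_def lin_def)

lemma times_in_quad:
  assumes "g \<in> quad m" "h \<in> quad m"
  shows "g * h \<in> quad m"
proof -
  have "g (cadd x (cadd y z)) * h (cadd x (cadd y z)) * (g czero * h czero) *
        (g x * h x * (g y * h y) * (g z * h z)) =
        g (cadd x y) * h (cadd x y) * (g (cadd y z) * h (cadd y z)) * (g (cadd x z) * h (cadd x z))"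
    if "x \<in> cube m" "y \<in> cube m" "z \<in> cube m" for x y z
  proof -
    have "(g (cadd x (cadd y z)) * g czero * (g x * g y * g z)) *
          (h (cadd x (cadd y z)) * h czero * (h x * h y * h z)) =
          (g (cadd x y) * g (cadd y z) * g (cadd x z)) * (h (cadd x y) * h (cadd y z) * h (cadd x z))"
      using assms that by (auto simp: quad_def)
    then show ?thesis by (simp add: mult_ac)
  qed
  moreover have "(g * h) x = 1 \<or> (g * h) x = - 1" for x
    using quad_sign[OF assms(1), of x] quad_sign[OF assms(2), of x] by auto
  ultimately show ?thesis
    using assms by (simp add: quad_def)
qed

lemma times_in_lin: "g \<in> lin m \<Longrightarrow> h \<in> lin m \<Longrightarrow> g * h \<in> lin m"
proof -
  assume g: "g \<in> lin m" and h: "h \<in> lin m"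
  have "(g * h) x = 1 \<or> (g * h) x = - 1" for x
    using lin_sign[OF g, of x] lin_sign[OF h, of x] by auto
  then show ?thesis using g h by (simp add: lin_def)
qed

lemma lin_subset_quad: "lin m \<subseteq> quad m"
proof
  fix g assume g: "g \<in> lin m"
  have sq: "g x * g x = 1" for x using lin_sign[OF g, of x] by auto
  have "g czero = 1" using lin_zero[OF g] .
  then show "g \<in> quad m"
    using g sq unfolding quad_def lin_def by (simp add: mult_ac)
qed

lemma quad_square: "g \<in> quad m \<Longrightarrow> g * g = 1"
proof
  fix x assume "g \<in> quad m"
  then show "(g * g) x = 1 x" using quad_sign[of g m x] by auto
qed

lemma low_rankI:
  "\<Lambda> \<subseteq> lin m \<Longrightarrow> finite \<Lambda> \<Longrightarrow> card \<Lambda> \<le> \<rho> \<Longrightarrow> determined m \<Lambda> g \<Longrightarrow> g \<in> low_rank m \<rho>"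
  unfolding low_rank_def by blast

lemma one_in_low_rank: "1 \<in> low_rank m a"
  by (rule low_rankI[of "{}"]) (auto simp: determined_def)

lemma lin_in_low_rank: "g \<in> lin m \<Longrightarrow> 1 \<le> a \<Longrightarrow> g \<in> low_rank m a"
  by (rule low_rankI[of "{g}"]) (auto simp: determined_def)

lemma times_in_low_rank:
  assumes "g \<in> low_rank m a" "h \<in> low_rank m b"
  shows "g * h \<in> low_rank m (a + b)"
proof -
  obtain A where A: "A \<subseteq> lin m" "finite A" "card A \<le> a" "determined m A g"
    using assms(1) by (auto simp: low_rank_def)
  obtain B where B: "B \<subseteq> lin m" "finite B" "card B \<le> b" "determined m B h"
    using assms(2) by (auto simp: low_rank_def)
  have "determined m (A \<union> B) (g * h)"
    unfolding determined_def
  proof (intro ballI impI)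
    fix x y assume xy: "x \<in> cube m" "y \<in> cube m" "\<forall>k\<in>A \<union> B. k x = k y"
    then have "g x = g y" "h x = h y" using A(4) B(4) unfolding determined_def by blast+
    then show "(g * h) x = (g * h) y" by simp
  qed
  moreover have "card (A \<union> B) \<le> a + b"
    using A B card_Un_le[of A B] by linarith
  ultimately show ?thesis
    using A B by (intro low_rankI[of "A \<union> B"]) auto
qed

section \<open>Polar form, radical and the Gauss sum bound\<close>

definition polar :: "((nat \<Rightarrow> bool) \<Rightarrow> real) \<Rightarrow> (nat \<Rightarrow> bool) \<Rightarrow> (nat \<Rightarrow> bool) \<Rightarrow> real" where
  "polar g h x = g (cadd h x) * g czero * g h * g x"

definition radical :: "nat \<Rightarrow> ((nat \<Rightarrow> bool) \<Rightarrow> real) \<Rightarrow> (nat \<Rightarrow> bool) set" where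
  "radical m g = {h\<in>cube m. \<forall>x\<in>cube m. polar g h x = 1}"

text \<open>\<open>polar g h x\<close> is \<open>(-1) ^ B(h, x)\<close> for the polar form B of the
  exponent. The identity in \<open>quad\<close> says that third differences of the exponent vanish,
  which is additivity of B. Values are signs, so multiplication serves as division.\<close>

lemma polar_mult:
  assumes g: "g \<in> quad m" and "x \<in> cube m" "y \<in> cube m" "h \<in> cube m"
  shows "polar g h (cadd x y) = polar g h x * polar g h y"
proof -
  have "g (cadd h (cadd x y)) * g czero * (g h * g x * g y) = g (cadd h x) * g (cadd x y) * g (cadd h y)"
    using assms by (auto simp: quad_def)
  then show ?thesis
    using quad_sign[OF g, of "cadd h (cadd x y)"] quad_sign[OF g, of czero] quad_sign[OF g, of h]
      quad_sign[OF g, of x] quad_sign[OF g, of y] quad_sign[OF g, of "cadd h x"]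
      quad_sign[OF g, of "cadd h y"] quad_sign[OF g, of "cadd x y"]
    unfolding polar_def by (elim disjE) simp_all
qed

lemma polar_commute: "polar g h x = polar g x h"
  by (simp add: polar_def cadd_commute mult_ac)

lemma polar_times_lin:
  assumes g: "g \<in> quad m" and l: "l \<in> lin m" and "h \<in> cube m" "x \<in> cube m"
  shows "polar (g * l) h x = polar g h x"
proof -
  have "l (cadd h x) = l h * l x" "l czero = 1"
    using assms(2-) lin_add[OF l] lin_zero[OF l] by auto
  then show ?thesis using lin_sign[OF l, of h] lin_sign[OF l, of x] by (auto simp: polar_def)
qed

lemma subgrp_radical:
  assumes g: "g \<in> quad m"
  shows "subgrp m (radical m g)"
proof -
  have "g x * g x = 1" for x using quad_sign[OF g, of x] by auto
  then have "polar g czero x = 1" for x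
    by (simp add: polar_def mult.assoc)
  moreover have "polar g (cadd x y) z = 1"
    if "x \<in> radical m g" "y \<in> radical m g" "z \<in> cube m" for x y z
  proof -
    have "polar g z x = 1" "polar g z y = 1"
      using that by (simp_all add: radical_def polar_commute[of g z])
    then show ?thesis
      using polar_mult[OF g, of x y z] that by (simp add: radical_def polar_commute[of g _ z])
  qed
  ultimately show ?thesis unfolding subgrp_def radical_def by auto
qed

text \<open>The classical Gauss sum argument: after substituting \<open>y = x + h\<close> in the
  squared sum, the inner sum over x is, up to sign, the sum of the multiplicative function
  \<open>polar g h\<close> and vanishes unless h lies in the radical.\<close>

lemma bias_le_radical:
  assumes g: "g \<in> quad m"
  shows "(\<Sum>x\<in>cube m. g x)\<^sup>2 \<le> 2 ^ m * real (card (radical m g))"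
proof -
  have sq: "g x * g x = 1" for x using quad_sign[OF g, of x] by auto
  have inner: "\<bar>\<Sum>x\<in>cube m. g x * g (cadd h x)\<bar> \<le> (if h \<in> radical m g then 2 ^ m else 0)"
    if h: "h \<in> cube m" for h
  proof (cases "h \<in> radical m g")
    case True
    have "\<bar>\<Sum>x\<in>cube m. g x * g (cadd h x)\<bar> \<le> (\<Sum>x\<in>cube m. \<bar>g x * g (cadd h x)\<bar>)" by (rule sum_abs)
    also have "\<dots> \<le> (\<Sum>x\<in>cube m. 1)"
    proof (rule sum_mono)
      fix x show "\<bar>g x * g (cadd h x)\<bar> \<le> 1"
        using quad_sign[OF g, of x] quad_sign[OF g, of "cadd h x"] by auto
    qed
    finally show ?thesis using True by (simp add: card_cube)
  next
    case False
    then obtain v where v: "v \<in> cube m" "polar g h v \<noteq> 1" using h by (auto simp: radical_def)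
    have "(\<Sum>x\<in>cube m. polar g h x) = 0"
      by (rule character_sum[where v = v]) (use polar_mult[OF g] h v in auto)
    moreover have "g x * g (cadd h x) = (g czero * g h) * polar g h x" for x
      using sq[of czero] sq[of h] by (simp add: polar_def algebra_simps)
    ultimately show ?thesis using False by (simp flip: sum_distrib_left)
  qed
  have "(\<Sum>x\<in>cube m. g x)\<^sup>2 = (\<Sum>x\<in>cube m. \<Sum>h\<in>cube m. g x * g h)"
    by (simp add: power2_eq_square sum_product)
  also have "\<dots> = (\<Sum>x\<in>cube m. \<Sum>h\<in>cube m. g x * g (cadd x h))"
    by (intro sum.cong refl sum_cube_translate[symmetric])
  also have "\<dots> = (\<Sum>h\<in>cube m. \<Sum>x\<in>cube m. g x * g (cadd h x))"
    by (subst sum.swap) (simp add: cadd_commute)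
  also have "\<dots> \<le> (\<Sum>h\<in>cube m. if h \<in> radical m g then 2 ^ m else 0)"
    using inner by (intro sum_mono) (smt (verit, best))
  also have "\<dots> = 2 ^ m * real (card (radical m g))"
  proof -
    have "cube m \<inter> {h. h \<in> radical m g} = radical m g" by (auto simp: radical_def)
    then show ?thesis by (simp add: sum.If_cases)
  qed
  finally show ?thesis .
qed

text \<open>On the radical \<open>g / g czero\<close> is multiplicative, so its kernel
  \<open>V\<close> has index at most two there; this halving is the reason for \<open>Suc t\<close>.
  Translations by \<open>V\<close> fix g, hence characters cutting out a subspace of
  \<open>V\<close> determine g.\<close>

lemma low_rank_of_radical:
  assumes g: "g \<in> quad m" and big: "2 ^ m \<le> card (radical m g) * 2 ^ t"
  shows "g \<in> low_rank m (Suc t)"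
proof -
  have sq: "g x * g x = 1" for x using quad_sign[OF g, of x] by auto
  let ?R = "radical m g"
  have sR: "subgrp m ?R" using subgrp_radical[OF g] .
  have Rsub: "?R \<subseteq> cube m" by (auto simp: radical_def)
  have shift: "g (cadd h x) = g czero * g h * g x" if "h \<in> ?R" "x \<in> cube m" for h x
  proof -
    have "polar g h x = 1" using that by (auto simp: radical_def)
    then show ?thesis
      using quad_sign[OF g, of "cadd h x"] quad_sign[OF g, of czero] quad_sign[OF g, of h] quad_sign[OF g, of x]
      unfolding polar_def by (elim disjE) simp_all
  qed
  define V where "V = {v\<in>?R. g v = g czero}"
  have V: "subgrp m V"
    using sR shift sq Rsub by (auto simp: subgrp_def V_def subset_iff)
  have finR: "finite ?R" using Rsub finite_cube finite_subset by blast
  have "card ?R \<le> 2 * card V"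
  proof (cases "?R = V")
    case False
    then obtain w where w: "w \<in> ?R" "g w \<noteq> g czero" by (auto simp: V_def)
    have "cadd w v \<in> V" if v: "v \<in> ?R - V" for v
    proof -
      have "g v \<noteq> g czero" "v \<in> ?R" using v by (auto simp: V_def)
      moreover have "cadd w v \<in> ?R" using w sR v by (auto simp: subgrp_def)
      ultimately show ?thesis
        using w shift[of w v] Rsub quad_sign[OF g, of v] quad_sign[OF g, of w] quad_sign[OF g, of czero]
        by (auto simp: V_def subset_iff)
    qed
    then have "cadd w ` (?R - V) \<subseteq> V" by auto
    moreover have "inj_on (cadd w) (?R - V)" by (rule inj_on_inverseI[of _ "cadd w"]) simp
    moreover have VR: "V \<subseteq> ?R" "finite V" using finR by (auto simp: V_def)
    ultimately have "card (?R - V) \<le> card V" by (intro card_inj_on_le)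
    moreover have "card ?R = card V + card (?R - V)"
      using finR VR by (simp add: card_Diff_subset card_mono)
    ultimately show ?thesis by simp
  qed simp
  then have "card ?R * 2 ^ t \<le> card V * 2 ^ Suc t" by simp
  then have "2 ^ m \<le> card V * 2 ^ Suc t" using big by linarith
  from subgrp_cut_out[OF V this] obtain \<Lambda> where L: "\<Lambda> \<subseteq> lin m" "finite \<Lambda>" "card \<Lambda> \<le> Suc t"
    "{x\<in>cube m. \<forall>l\<in>\<Lambda>. l x = 1} \<subseteq> V" by blast
  have "determined m \<Lambda> g"
    unfolding determined_def
  proof (intro ballI impI)
    fix x y assume xy: "x \<in> cube m" "y \<in> cube m" "\<forall>l\<in>\<Lambda>. l x = l y"
    have "l (cadd x y) = 1" if "l \<in> \<Lambda>" for l
    proof -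
      have "l \<in> lin m" using that L by auto
      then have "l (cadd x y) = l x * l y" using xy by (auto simp: lin_def)
      then show ?thesis using xy that lin_sign[OF \<open>l \<in> lin m\<close>, of y] by auto
    qed
    then have "cadd x y \<in> V" using L(4) xy by auto
    then have "g (cadd (cadd x y) y) = g czero * g czero * g y" using shift xy(2) by (auto simp: V_def)
    moreover have "cadd (cadd x y) y = x" by (auto simp: cadd_def)
    ultimately show "g x = g y" using sq by simp
  qed
  then show ?thesis using L by (intro low_rankI[of \<Lambda>])
qed

text \<open>Multiplying by a character leaves the polar form and the radical unchanged, so the bound
  is uniform in l.\<close>

lemma high_rank_bias:
  assumes g: "g \<in> quad m" and l: "l \<in> lin m" and hr: "g \<notin> low_rank m (Suc t)"
  shows "(\<Sum>x\<in>cube m. (g * l) x)\<^sup>2 \<le> (2 ^ m)\<^sup>2 / 2 ^ t"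
proof -
  have "card (radical m g) * 2 ^ t < 2 ^ m"
    using low_rank_of_radical[OF g] hr by (meson not_less)
  then have "real (card (radical m g) * 2 ^ t) < real (2 ^ m)" by (simp only: of_nat_less_iff)
  then have r: "real (card (radical m g)) \<le> 2 ^ m / 2 ^ t" by (simp add: field_simps)
  have "radical m (g * l) = radical m g"
    using polar_times_lin[OF g l] by (auto simp: radical_def)
  moreover have "g * l \<in> quad m" using g l lin_subset_quad times_in_quad by blast
  ultimately have "(\<Sum>x\<in>cube m. (g * l) x)\<^sup>2 \<le> 2 ^ m * real (card (radical m g))"
    using bias_le_radical[of "g * l" m] by simp
  also have "\<dots> \<le> 2 ^ m * (2 ^ m / 2 ^ t)" using r by (intro mult_left_mono) auto
  finally show ?thesis by (simp add: power2_eq_square)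
qed

section \<open>Signs of polynomials of degree at most two\<close>

definition sgn_fun :: "nat \<Rightarrow> ((nat \<Rightarrow> bool) \<Rightarrow> bool) \<Rightarrow> (nat \<Rightarrow> bool) \<Rightarrow> real" where
  "sgn_fun m Q x = (if x \<in> cube m \<and> Q x then -1 else 1)"

lemma monomial_quad:
  assumes "card S \<le> 2" "finite S"
  shows "sgn_fun m (\<lambda>x. \<forall>i\<in>S. x i) \<in> quad m"
proof -
  \<comment> \<open>\<open>i = j\<close> is allowed and covers the linear monomials.\<close>
  have "S = {} \<or> (\<exists>i j. S = {i, j})"
  proof -
    consider "card S = 0" | "card S = 1" | "card S = 2" using assms by linarith
    then show ?thesis using assms by cases (auto simp: card_1_singleton_iff card_2_iff)
  qed
  then show ?thesis
  proof
    assume "\<exists>i j. S = {i, j}"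
    then obtain i j where S: "S = {i, j}" by auto
    \<comment> \<open>The third-difference identity for a product of two bits, checked over all 64
      assignments; the factor at \<open>czero\<close> equals 1 and is omitted.\<close>
    have "(if a \<noteq> (b \<noteq> c) \<and> a' \<noteq> (b' \<noteq> c') then -1 else 1) *
       ((if a \<and> a' then -1 else 1) * (if b \<and> b' then -1 else 1) * (if c \<and> c' then -1 else 1)) =
       (if a \<noteq> b \<and> a' \<noteq> b' then -1 else 1) * (if b \<noteq> c \<and> b' \<noteq> c' then -1 else 1) *
       (if a \<noteq> c \<and> a' \<noteq> c' then -1 else (1::real))" for a b c a' b' c'
      by (cases a; cases b; cases c; cases a'; cases b'; cases c'; simp only: simp_thms if_True if_False; simp)
    note key = this
    have val: "sgn_fun m (\<lambda>x. \<forall>i\<in>S. x i) x = (if x i \<and> x j then -1 else 1)" if "x \<in> cube m" for x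
      using that by (simp add: sgn_fun_def S)
    show ?thesis
      unfolding quad_def mem_Collect_eq
    proof (intro conjI ballI allI impI)
      fix x y z assume "x \<in> cube m" "y \<in> cube m" "z \<in> cube m"
      then show "sgn_fun m (\<lambda>x. \<forall>i\<in>S. x i) (cadd x (cadd y z)) * sgn_fun m (\<lambda>x. \<forall>i\<in>S. x i) czero *
          (sgn_fun m (\<lambda>x. \<forall>i\<in>S. x i) x * sgn_fun m (\<lambda>x. \<forall>i\<in>S. x i) y * sgn_fun m (\<lambda>x. \<forall>i\<in>S. x i) z) =
          sgn_fun m (\<lambda>x. \<forall>i\<in>S. x i) (cadd x y) * sgn_fun m (\<lambda>x. \<forall>i\<in>S. x i) (cadd y z) *
          sgn_fun m (\<lambda>x. \<forall>i\<in>S. x i) (cadd x z)"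
        using key[of "x i" "y i" "z i" "x j" "y j" "z j"]
        by (simp only: val cadd_in_cube czero_in_cube) (simp only: cadd_def simp_thms if_False mult_1_right)
    qed (auto simp: sgn_fun_def)
  qed (simp add: quad_def sgn_fun_def)
qed

lemma sgn_fun_quad:
  assumes "poly_deg_le m 2 Q"
  shows "sgn_fun m Q \<in> quad m"
proof -
  obtain C where C: "C \<subseteq> {S. S \<subseteq> {..<m} \<and> card S \<le> 2}"
    and Q: "\<forall>x\<in>cube m. Q x = odd (card {S\<in>C. \<forall>i\<in>S. x i})"
    using assms by (auto simp: poly_deg_le_def)
  have "finite C" by (rule finite_subset[OF C]) auto
  then have "C \<subseteq> {S. S \<subseteq> {..<m} \<and> card S \<le> 2} \<Longrightarrow>
    sgn_fun m (\<lambda>x. odd (card {S\<in>C. \<forall>i\<in>S. x i})) \<in> quad m"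
  proof (induction C)
    case empty
    then show ?case by (auto simp: sgn_fun_def quad_def)
  next
    case (insert S C)
    have eq: "sgn_fun m (\<lambda>x. odd (card {T\<in>insert S C. \<forall>i\<in>T. x i})) =
          sgn_fun m (\<lambda>x. \<forall>i\<in>S. x i) * sgn_fun m (\<lambda>x. odd (card {T\<in>C. \<forall>i\<in>T. x i}))"
    proof
      fix x
      have "{T\<in>insert S C. \<forall>i\<in>T. x i} =
          (if \<forall>i\<in>S. x i then insert S {T\<in>C. \<forall>i\<in>T. x i} else {T\<in>C. \<forall>i\<in>T. x i})" by auto
      then show "sgn_fun m (\<lambda>x. odd (card {T\<in>insert S C. \<forall>i\<in>T. x i})) x =
          (sgn_fun m (\<lambda>x. \<forall>i\<in>S. x i) * sgn_fun m (\<lambda>x. odd (card {T\<in>C. \<forall>i\<in>T. x i}))) x"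
        using insert.hyps by (simp add: sgn_fun_def)
    qed
    have "finite S" using insert.prems by (auto intro: finite_subset)
    then show ?case
      unfolding eq using insert.prems by (intro times_in_quad monomial_quad insert.IH) auto
  qed
  moreover have "sgn_fun m (\<lambda>x. odd (card {S\<in>C. \<forall>i\<in>S. x i})) = sgn_fun m Q"
    using Q by (auto simp: sgn_fun_def)
  ultimately show ?thesis using C by simp
qed

section \<open>Elimination of short relations\<close>

text \<open>The F_2-span in multiplicative notation: when all elements of a finite \<open>X\<close>
  square to 1, the subset products already form the generated subgroup.\<close>

definition sp :: "'v::comm_monoid_mult set \<Rightarrow> 'v set" where
  "sp X = {\<Prod>Y |Y. Y \<subseteq> X}"

lemma sp_I: "Y \<subseteq> X \<Longrightarrow> \<Prod>Y \<in> sp X"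
  by (auto simp: sp_def)

lemma prod_sym_diff:
  fixes Y Z :: "'v::comm_monoid_mult set"
  assumes "finite Y" "finite Z" "\<And>x. x \<in> Y \<inter> Z \<Longrightarrow> x * x = 1"
  shows "\<Prod>Y * \<Prod>Z = \<Prod>((Y - Z) \<union> (Z - Y))"
proof -
  have "\<Prod>(Y \<inter> Z) * \<Prod>(Y \<inter> Z) = (\<Prod>x\<in>Y \<inter> Z. x * x)" by (simp add: prod.distrib)
  also have "\<dots> = 1" using assms(3) by (intro prod.neutral) blast
  finally have sq: "\<Prod>(Y \<inter> Z) * \<Prod>(Y \<inter> Z) = 1" .
  have "\<Prod>Y = \<Prod>(Y - Z) * \<Prod>(Y \<inter> Z)"
    by (subst prod.union_disjoint[symmetric]) (use assms in \<open>auto intro!: arg_cong[of _ _ Prod]\<close>)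
  moreover have "\<Prod>Z = \<Prod>(Z - Y) * \<Prod>(Y \<inter> Z)"
    by (subst prod.union_disjoint[symmetric]) (use assms in \<open>auto intro!: arg_cong[of _ _ Prod]\<close>)
  ultimately have "\<Prod>Y * \<Prod>Z = \<Prod>(Y - Z) * \<Prod>(Z - Y) * (\<Prod>(Y \<inter> Z) * \<Prod>(Y \<inter> Z))"
    by (simp add: mult_ac)
  also have "\<dots> = \<Prod>(Y - Z) * \<Prod>(Z - Y)" unfolding sq by simp
  also have "\<dots> = \<Prod>((Y - Z) \<union> (Z - Y))"
    by (subst prod.union_disjoint) (use assms in auto)
  finally show ?thesis .
qed

lemma sp_mult:
  assumes X: "finite X" "\<And>x. x \<in> X \<Longrightarrow> x * x = 1" and "u \<in> sp X" "v \<in> sp X"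
  shows "u * v \<in> sp X"
proof -
  obtain Y Z where "Y \<subseteq> X" "u = \<Prod>Y" "Z \<subseteq> X" "v = \<Prod>Z" using assms by (auto simp: sp_def)
  moreover from this have "finite Y" "finite Z" using X finite_subset by blast+
  moreover have "\<Prod>Y * \<Prod>Z = \<Prod>((Y - Z) \<union> (Z - Y))"
    using calculation X(2) by (intro prod_sym_diff) auto
  ultimately show ?thesis by (simp only:) (intro sp_I, auto)
qed

lemma pigeonhole_fiber:
  assumes "finite W" "f ` I \<subseteq> W" "card W * N \<le> card I" "0 < N" "W \<noteq> {}"
  shows "\<exists>w\<in>W. N \<le> card {i\<in>I. f i = w}"
proof (rule ccontr)
  assume "\<not> ?thesis"
  then have lt: "card {i\<in>I. f i = w} < N" if "w \<in> W" for w using that by auto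
  have "I = (\<Union>w\<in>W. {i\<in>I. f i = w})" using assms(2) by auto
  then have "card I \<le> (\<Sum>w\<in>W. card {i\<in>I. f i = w})" using card_UN_le[OF assms(1)] by metis
  also have "\<dots> < (\<Sum>w\<in>W. N)" using lt assms by (intro sum_strict_mono) auto
  finally show False using assms by simp
qed

text \<open>An elementary abelian 2-group with a subadditive notion of smallness. It is instantiated
  twice: with quadratic signs graded by \<open>low_rank\<close>, and with characters where only 1
  counts as small. A carrier \<open>G\<close> inside a monoid avoids making the sign functions a
  type of their own.\<close>

locale filtered_group =
  fixes G :: "'v::comm_monoid_mult set" and S :: "nat \<Rightarrow> 'v set"
  assumes G_one: "1 \<in> G"
    and G_mult: "g \<in> G \<Longrightarrow> h \<in> G \<Longrightarrow> g * h \<in> G"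
    and G_square: "g \<in> G \<Longrightarrow> g * g = 1"
    and S_one: "1 \<in> S a"
    and S_mult: "g \<in> S a \<Longrightarrow> h \<in> S b \<Longrightarrow> g * h \<in> S (a + b)"
begin

text \<open>Relations across more than two indices are not excluded, because only second moments are
  taken later. Taking \<open>B\<close> and \<open>D\<close> empty includes relations inside the
  core.\<close>

definition clean :: "'v set \<Rightarrow> ('i \<Rightarrow> 'v set) \<Rightarrow> 'i set \<Rightarrow> nat \<Rightarrow> bool" where
  "clean C F J \<tau> \<longleftrightarrow> (\<forall>i\<in>J. \<forall>j\<in>J. i \<noteq> j \<longrightarrow>
     (\<forall>A B D. A \<subseteq> C \<longrightarrow> B \<subseteq> F i \<longrightarrow> D \<subseteq> F j \<longrightarrow> A \<noteq> {} \<or> B \<noteq> {} \<or> D \<noteq> {} \<longrightarrow>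
        \<Prod>A * \<Prod>B * \<Prod>D \<notin> S \<tau>))"

text \<open>Invariant of the elimination: \<open>K\<close> holds the original generators, and
  \<sigma> bounds the error accumulated in rewriting them.\<close>

definition covers :: "'v set \<Rightarrow> ('i \<Rightarrow> 'v set) \<Rightarrow> ('i \<Rightarrow> 'v set) \<Rightarrow> nat \<Rightarrow> 'i set \<Rightarrow> bool" where
  "covers C F K \<sigma> I \<longleftrightarrow> (\<forall>i\<in>I. \<forall>h\<in>K i. \<exists>e\<in>S \<sigma>. \<exists>u\<in>sp (C \<union> F i). h = e * u)"

lemma Prod_in_G: "X \<subseteq> G \<Longrightarrow> \<Prod>X \<in> G"
  by (induction X rule: infinite_finite_induct) (auto simp: G_one G_mult)

lemma S_mono: "a \<le> b \<Longrightarrow> g \<in> S a \<Longrightarrow> g \<in> S b"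
  using S_mult[of g a 1 "b - a"] S_one by simp

text \<open>Replacing b by \<open>c * v\<close> in a word brings in the error c at most once, since
  b occurs at most once in a subset product; hence \<sigma> grows by \<tau> only.\<close>

lemma eliminate_generator:
  assumes X: "X \<subseteq> G" "finite X" and X': "X' \<subseteq> G" "finite X'" and sub: "X - {b} \<subseteq> X'"
    and b: "b = c * v" "c \<in> S \<tau>" "v \<in> sp X'"
    and h: "\<exists>e\<in>S \<sigma>. \<exists>u\<in>sp X. h = e * u"
  shows "\<exists>e\<in>S (\<sigma> + \<tau>). \<exists>u\<in>sp X'. h = e * u"
proof -
  obtain e Y where e: "e \<in> S \<sigma>" and Y: "Y \<subseteq> X" and hY: "h = e * \<Prod>Y"
    using h by (auto simp: sp_def)
  show ?thesis
  proof (cases "b \<in> Y")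
    case True
    have fY: "finite Y" using X Y finite_subset by blast
    have "h = (e * c) * (v * \<Prod>(Y - {b}))"
      using prod.remove[OF fY True, of "\<lambda>x. x"] hY b(1) by (simp add: mult_ac)
    moreover have "v * \<Prod>(Y - {b}) \<in> sp X'"
      using X' b(3) Y sub G_square by (intro sp_mult sp_I) auto
    ultimately show ?thesis using S_mult[OF e b(2)] by blast
  next
    case False
    then have "\<Prod>Y \<in> sp X'" using Y sub by (intro sp_I) auto
    then show ?thesis using hY e S_mono[of \<sigma> "\<sigma> + \<tau>" e] by auto
  qed
qed

text \<open>Every element of \<open>G\<close> is its own inverse, so a relation can be solved for
  any generator that occurs in it.\<close>

lemma solve_for_factor:
  assumes "finite B" "b \<in> B" "B \<subseteq> G" "A \<subseteq> G" "w \<in> G" "c = \<Prod>A * \<Prod>B * w"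
  shows "b = c * (\<Prod>A * \<Prod>(B - {b}) * w)"
proof -
  have "c = b * (\<Prod>A * \<Prod>(B - {b}) * w)"
    using assms(6) prod.remove[OF assms(1,2), of "\<lambda>x. x"] by (simp add: mult_ac)
  moreover have "\<Prod>A * \<Prod>(B - {b}) * w \<in> G"
    using assms by (intro G_mult Prod_in_G) auto
  ultimately show ?thesis by (metis G_square mult.assoc mult.right_neutral)
qed

text \<open>Take an inclusion-maximal conflict-free set \<open>J\<close> of indices. If it has fewer
  than k elements, every other index conflicts with one of at most \<open>1 + k * 2 ^ d\<close>
  words built from the private parts of \<open>J\<close>, and the pigeonhole principle gives one
  word w shared by \<open>N\<close> indices. The trivial word stands for a relation between the core
  and a single private part.\<close>

lemma clean_or_common_word:
  assumes fin: "finite I" "finite C" and F: "\<forall>i\<in>I. finite (F i) \<and> card (F i) \<le> d"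
    and k: "0 < k" "k \<le> N" and big: "4 * k * 2 ^ d * N \<le> card I"
    and core: "\<forall>A\<subseteq>C. A \<noteq> {} \<longrightarrow> \<Prod>A \<notin> S \<tau>"
  shows "(\<exists>J\<subseteq>I. card J = k \<and> clean C F J \<tau>) \<or>
    (\<exists>I'\<subseteq>I. \<exists>w. (w = 1 \<or> (\<exists>j\<in>I. w \<in> sp (F j))) \<and> N \<le> card I' \<and>
       (\<forall>i\<in>I'. \<exists>A B. A \<subseteq> C \<and> B \<subseteq> F i \<and> B \<noteq> {} \<and> \<Prod>A * \<Prod>B * w \<in> S \<tau>))"
proof -
  define pair where "pair i w \<longleftrightarrow> (\<exists>A B. A \<subseteq> C \<and> B \<subseteq> F i \<and> B \<noteq> {} \<and> \<Prod>A * \<Prod>B * w \<in> S \<tau>)" for i w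
  define indep where "indep i j \<longleftrightarrow> (\<forall>D. D \<subseteq> F j \<longrightarrow> D \<noteq> {} \<longrightarrow> \<not> pair i (\<Prod>D))" for i j
  define ok where "ok J \<longleftrightarrow> J \<subseteq> I \<and> (\<forall>i\<in>J. \<not> pair i 1) \<and>
    (\<forall>i\<in>J. \<forall>j\<in>J. i \<noteq> j \<longrightarrow> indep i j)" for J
  have clean_ok: "clean C F J \<tau>" if J: "ok J" for J
    unfolding clean_def
  proof (intro ballI allI impI)
    fix i j A B D
    assume ij: "i \<in> J" "j \<in> J" "i \<noteq> j" and ABD: "A \<subseteq> C" "B \<subseteq> F i" "D \<subseteq> F j"
      and ne: "A \<noteq> {} \<or> B \<noteq> {} \<or> D \<noteq> {}"
    consider "B = {}" "D = {}" | "B \<noteq> {}" "D = {}" | "B = {}" "D \<noteq> {}" | "B \<noteq> {}" "D \<noteq> {}" by blast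
    then show "\<Prod>A * \<Prod>B * \<Prod>D \<notin> S \<tau>"
    proof cases
      case 1 then show ?thesis using ne core ABD by simp
    next
      case 2
      have "\<not> pair i 1" using J ij by (simp add: ok_def)
      then have "\<Prod>A * \<Prod>B * 1 \<notin> S \<tau>" using 2 ABD unfolding pair_def by blast
      then show ?thesis using 2 by simp
    next
      case 3
      have "\<not> pair j 1" using J ij by (simp add: ok_def)
      then have "\<Prod>A * \<Prod>D * 1 \<notin> S \<tau>" using 3 ABD unfolding pair_def by blast
      then show ?thesis using 3 by simp
    next
      case 4
      have "\<not> pair i (\<Prod>D)" using J ij ABD 4 by (simp add: ok_def indep_def)
      then show ?thesis using 4 ABD unfolding pair_def by blast
    qed
  qed
  have "finite {J. ok J}" by (rule finite_subset[of _ "Pow I"]) (auto simp: ok_def fin)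
  moreover have "{} \<in> {J. ok J}" by (simp add: ok_def)
  ultimately obtain J where J: "ok J" and mx: "\<And>J'. ok J' \<Longrightarrow> J \<subseteq> J' \<Longrightarrow> J' = J"
    by (metis (no_types, lifting) finite_has_maximal2 mem_Collect_eq)
  have JI: "J \<subseteq> I" "finite J" using J fin finite_subset by (auto simp: ok_def)
  show ?thesis
  proof (cases "k \<le> card J")
    case True
    then obtain J0 where "J0 \<subseteq> J" "card J0 = k" by (meson obtain_subset_with_card_n)
    moreover from this have "ok J0" using J unfolding ok_def by blast
    ultimately have "J0 \<subseteq> I \<and> card J0 = k \<and> clean C F J0 \<tau>" using clean_ok[of J0] JI by auto
    then show ?thesis by (intro disjI1 exI[of _ J0])
  next
    case False
    define W where "W = insert 1 (\<Union>j\<in>J. (\<lambda>D. \<Prod>D) ` Pow (F j))"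
    have finW: "finite W" using JI F by (auto simp: W_def)
    have "card (\<Union>j\<in>J. (\<lambda>D. \<Prod>D) ` Pow (F j)) \<le> (\<Sum>j\<in>J. card ((\<lambda>D. \<Prod>D) ` Pow (F j)))"
      by (rule card_UN_le) (rule JI)
    also have "\<dots> \<le> (\<Sum>j\<in>J. 2 ^ d)"
    proof (rule sum_mono)
      fix j assume "j \<in> J"
      then have Fj: "finite (F j)" "card (F j) \<le> d" using F JI by auto
      have "card ((\<lambda>D. \<Prod>D) ` Pow (F j)) \<le> card (Pow (F j))" using Fj by (intro card_image_le) auto
      also have "\<dots> \<le> 2 ^ d" using Fj by (simp add: card_Pow)
      finally show "card ((\<lambda>D. \<Prod>D) ` Pow (F j)) \<le> 2 ^ d" .
    qed
    also have "\<dots> \<le> k * 2 ^ d" using False by simp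
    finally have "card W \<le> 1 + k * 2 ^ d"
      using card_insert_le_m1[of "1 + k * 2 ^ d" "\<Union>j\<in>J. (\<lambda>D. \<Prod>D) ` Pow (F j)" 1] by (simp add: W_def)
    have W1: "1 \<in> W" and WI: "\<And>j D. j \<in> J \<Longrightarrow> D \<subseteq> F j \<Longrightarrow> \<Prod>D \<in> W"
      unfolding W_def by blast+
    \<comment> \<open>Without a conflict, \<open>insert i J\<close> would be admissible. A conflict
      recorded from the side of j becomes one for i by commuting the two private words.\<close>
    have hit: "\<exists>w\<in>W. pair i w" if i: "i \<in> I - J" for i
    proof (rule ccontr)
      assume none: "\<not> ?thesis"
      have "\<not> pair j (\<Prod>D)" if j: "j \<in> J" "D \<subseteq> F i" "D \<noteq> {}" for j D
      proof
        assume "pair j (\<Prod>D)"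
        then obtain A B where AB: "A \<subseteq> C" "B \<subseteq> F j" "B \<noteq> {}" "\<Prod>A * \<Prod>B * \<Prod>D \<in> S \<tau>"
          by (auto simp: pair_def)
        then have "\<Prod>A * \<Prod>D * \<Prod>B \<in> S \<tau>" by (simp add: mult_ac)
        then have "pair i (\<Prod>B)" using AB j unfolding pair_def by blast
        moreover have "\<Prod>B \<in> W" using AB j WI by blast
        ultimately show False using none by blast
      qed
      then have "indep j i" if "j \<in> J" for j using that by (simp add: indep_def)
      moreover have "\<not> pair i 1" "\<And>j. j \<in> J \<Longrightarrow> indep i j"
        using none W1 WI by (auto simp: indep_def)
      ultimately have "ok (insert i J)" using J i unfolding ok_def by auto
      then show False using mx[of "insert i J"] i by auto
    qed
    then obtain f where f: "\<And>i. i \<in> I - J \<Longrightarrow> f i \<in> W \<and> pair i (f i)" by metis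
    have k2: "1 \<le> k * 2 ^ d" using k by simp
    have "card W * N \<le> (1 + k * 2 ^ d) * N" by (rule mult_le_mono1) (rule \<open>card W \<le> 1 + k * 2 ^ d\<close>)
    \<comment> \<open>The factor 4 pays for the trivial word and for the discarded indices of
      \<open>J\<close>, whose number is below \<open>k \<le> N\<close>.\<close>
    moreover have "(1 + k * 2 ^ d) * N + N \<le> 4 * k * 2 ^ d * N"
    proof -
      have "(1 + k * 2 ^ d) + 1 \<le> 4 * (k * 2 ^ d)" using k2 by linarith
      then have "((1 + k * 2 ^ d) + 1) * N \<le> 4 * (k * 2 ^ d) * N" by (rule mult_le_mono1)
      then show ?thesis by (simp add: algebra_simps)
    qed
    moreover have "card I = card (I - J) + card J"
      using JI fin by (simp add: card_Diff_subset card_mono)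
    ultimately have "card W * N \<le> card (I - J)" using big k False by linarith
    moreover have "f ` (I - J) \<subseteq> W" "W \<noteq> {}" "0 < N" using f k W1 by auto
    ultimately obtain w where w: "w \<in> W" "N \<le> card {i\<in>I - J. f i = w}"
      using pigeonhole_fiber[of W f "I - J" N] finW f k W1 by blast
    define I' where "I' = {i\<in>I - J. f i = w}"
    have "w = 1 \<or> (\<exists>j\<in>I. w \<in> sp (F j))"
      using w(1) JI by (auto simp: W_def sp_def)
    moreover have "\<forall>i\<in>I'. pair i w" "I' \<subseteq> I" using f by (auto simp: I'_def)
    moreover have "N \<le> card I'" using w(2) by (simp add: I'_def)
    ultimately show ?thesis unfolding pair_def by blast
  qed
qed

text \<open>A step removes a private generator at the price of at most one core generator, or removes a core
  generator; so \<open>2 * card (F i) + card C\<close> decreases.\<close>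

theorem elimination:
  assumes "finite I" "finite C" "C \<subseteq> G"
    and "\<And>i. i \<in> I \<Longrightarrow> finite (F i) \<and> F i \<subseteq> G \<and> 2 * card (F i) + card C \<le> M \<and> card (F i) + card C \<le> d"
    and "covers C F K \<sigma> I" "0 < k" "k * (4 * k * 2 ^ d) ^ M \<le> card I"
  shows "\<exists>J C' F' \<sigma>'. J \<subseteq> I \<and> card J = k \<and> finite C' \<and> C' \<subseteq> G \<and>
    (\<forall>i\<in>J. finite (F' i) \<and> F' i \<subseteq> G \<and> card (F' i) + card C' \<le> d) \<and>
    covers C' F' K \<sigma>' J \<and> clean C' F' J (a * \<sigma>') \<and> \<sigma> \<le> \<sigma>' \<and> \<sigma>' \<le> (a + 1) ^ M * \<sigma>"
  using assms
proof (induction M arbitrary: I C F \<sigma>)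
  case 0
  then obtain J where J: "J \<subseteq> I" "card J = k" by (metis mult.right_neutral obtain_subset_with_card_n power_0)
  \<comment> \<open>Since \<open>k > 0\<close>, some index is present, so the measure bound 0
    empties the core and the private parts.\<close>
  have "J \<noteq> {}" using J 0 by auto
  then have "C = {}" "\<forall>i\<in>J. F i = {}" using 0 J by fastforce+
  then have "clean C F J (a * \<sigma>)" by (simp add: clean_def)
  moreover have "covers C F K \<sigma> J" using 0(5) J by (auto simp: covers_def)
  moreover have "\<forall>i\<in>J. finite (F i) \<and> F i \<subseteq> G \<and> card (F i) + card C \<le> d" using 0(4) J by blast
  ultimately show ?case using J 0(2,3) by (intro exI[of _ J] exI[of _ C] exI[of _ F] exI[of _ \<sigma>]) auto
next
  case (Suc M)
  let ?\<tau> = "a * \<sigma>"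
  let ?N = "k * (4 * k * 2 ^ d) ^ M"
  have kN: "k \<le> ?N" using Suc.prems(6) by simp
  have bigI: "4 * k * 2 ^ d * ?N \<le> card I" using Suc.prems(7) by (simp add: mult_ac)
  have NI: "?N \<le> card I"
  proof -
    have "1 * ?N \<le> (4 * k * 2 ^ d) * ?N" using Suc.prems(6) by (intro mult_le_mono1) simp
    then show ?thesis using bigI by linarith
  qed
  have I0: "I \<noteq> {}" using NI kN Suc.prems(6) by auto
  \<comment> \<open>\<open>\<sigma> + a * \<sigma> = (a + 1) * \<sigma>\<close>: one replacement
    costs one factor of the final bound.\<close>
  have bound: "\<sigma> + ?\<tau> \<le> \<sigma>' \<and> \<sigma>' \<le> (a + 1) ^ M * (\<sigma> + ?\<tau>) \<Longrightarrow> \<sigma> \<le> \<sigma>' \<and> \<sigma>' \<le> (a + 1) ^ Suc M * \<sigma>" for \<sigma>'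
    by (simp add: algebra_simps)
  show ?case
  proof (cases "\<exists>A\<subseteq>C. A \<noteq> {} \<and> \<Prod>A \<in> S ?\<tau>")
    case True
    \<comment> \<open>A small word inside the core removes a core generator for all indices at once;
      no index is discarded.\<close>
    then obtain A b where A: "A \<subseteq> C" "b \<in> A" "\<Prod>A \<in> S ?\<tau>" by blast
    let ?C = "C - {b}"
    have finA: "finite A" using A Suc.prems finite_subset by blast
    have beq: "b = \<Prod>A * (\<Prod>{} * \<Prod>(A - {b}) * 1)"
      using A Suc.prems finA by (intro solve_for_factor[of A b "{}" 1]) (auto simp: G_one)
    have card: "card C = Suc (card ?C)" using A Suc.prems by (metis card_Suc_Diff1 subsetD)
    have "covers ?C F K (\<sigma> + ?\<tau>) I"
      unfolding covers_def
    proof (intro ballI)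
      fix i h assume ih: "i \<in> I" "h \<in> K i"
      show "\<exists>e\<in>S (\<sigma> + ?\<tau>). \<exists>u\<in>sp (?C \<union> F i). h = e * u"
        by (rule eliminate_generator[where X = "C \<union> F i" and b = b and c = "\<Prod>A" and v = "\<Prod>{} * \<Prod>(A - {b}) * 1"])
           (use Suc.prems(2,3,5) Suc.prems(4)[OF ih(1)] ih A beq in \<open>auto simp: covers_def intro!: sp_I\<close>)
    qed
    then have "\<exists>J C' F' \<sigma>'. J \<subseteq> I \<and> card J = k \<and> finite C' \<and> C' \<subseteq> G \<and>
      (\<forall>i\<in>J. finite (F' i) \<and> F' i \<subseteq> G \<and> card (F' i) + card C' \<le> d) \<and>
      covers C' F' K \<sigma>' J \<and> clean C' F' J (a * \<sigma>') \<and> \<sigma> + ?\<tau> \<le> \<sigma>' \<and> \<sigma>' \<le> (a + 1) ^ M * (\<sigma> + ?\<tau>)"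
    proof (intro Suc.IH)
      fix i assume "i \<in> I"
      from Suc.prems(4)[OF this] show "finite (F i) \<and> F i \<subseteq> G \<and> 2 * card (F i) + card ?C \<le> M \<and> card (F i) + card ?C \<le> d"
        using card by auto
    qed (use Suc.prems NI in auto)
    then show ?thesis
    proof (elim ex_forward)
      fix J C' F' \<sigma>'
      assume *: "J \<subseteq> I \<and> card J = k \<and> finite C' \<and> C' \<subseteq> G \<and>
        (\<forall>i\<in>J. finite (F' i) \<and> F' i \<subseteq> G \<and> card (F' i) + card C' \<le> d) \<and>
        covers C' F' K \<sigma>' J \<and> clean C' F' J (a * \<sigma>') \<and> \<sigma> + ?\<tau> \<le> \<sigma>' \<and> \<sigma>' \<le> (a + 1) ^ M * (\<sigma> + ?\<tau>)"
      then have "J \<subseteq> I" "\<sigma> \<le> \<sigma>' \<and> \<sigma>' \<le> (a + 1) ^ Suc M * \<sigma>"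
        using bound by blast+
      with * show "J \<subseteq> I \<and> card J = k \<and> finite C' \<and> C' \<subseteq> G \<and>
        (\<forall>i\<in>J. finite (F' i) \<and> F' i \<subseteq> G \<and> card (F' i) + card C' \<le> d) \<and>
        covers C' F' K \<sigma>' J \<and> clean C' F' J (a * \<sigma>') \<and> \<sigma> \<le> \<sigma>' \<and> \<sigma>' \<le> (a + 1) ^ Suc M * \<sigma>"
        by blast
    qed
  next
    case False
    have Fd: "\<forall>i\<in>I. finite (F i) \<and> card (F i) \<le> d"
      using Suc.prems(4) add_leD1 by blast
    have core: "\<forall>A\<subseteq>C. A \<noteq> {} \<longrightarrow> \<Prod>A \<notin> S ?\<tau>" using False by blast
    from clean_or_common_word[OF Suc.prems(1,2) Fd Suc.prems(6) kN bigI core]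
    show ?thesis
    proof
      assume "\<exists>J\<subseteq>I. card J = k \<and> clean C F J ?\<tau>"
      then obtain J where clean: "J \<subseteq> I" "card J = k" "clean C F J ?\<tau>"
        by (elim exE conjE) (rule that)
      moreover have "covers C F K \<sigma> J" using Suc.prems(5) clean by (auto simp: covers_def)
      moreover have "1 * \<sigma> \<le> (a + 1) ^ Suc M * \<sigma>" by (intro mult_le_mono1 one_le_power) simp
      moreover have "\<forall>i\<in>J. finite (F i) \<and> F i \<subseteq> G \<and> card (F i) + card C \<le> d"
        using Suc.prems(4) clean(1) by blast
      ultimately show ?thesis
        using Suc.prems(2,3) clean by (intro exI[of _ J] exI[of _ C] exI[of _ F] exI[of _ \<sigma>]) auto
    next
      assume "\<exists>I'\<subseteq>I. \<exists>w. (w = 1 \<or> (\<exists>j\<in>I. w \<in> sp (F j))) \<and> ?N \<le> card I' \<and>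
        (\<forall>i\<in>I'. \<exists>A B. A \<subseteq> C \<and> B \<subseteq> F i \<and> B \<noteq> {} \<and> \<Prod>A * \<Prod>B * w \<in> S ?\<tau>)"
      then obtain I' w where common: "I' \<subseteq> I" "w = 1 \<or> (\<exists>j\<in>I. w \<in> sp (F j))" "?N \<le> card I'"
         "\<forall>i\<in>I'. \<exists>A B. A \<subseteq> C \<and> B \<subseteq> F i \<and> B \<noteq> {} \<and> \<Prod>A * \<Prod>B * w \<in> S ?\<tau>"
        by (elim exE conjE) (rule that)
      have wG: "w \<in> G" using common(2) Suc.prems(4) by (fastforce simp: sp_def intro: G_one Prod_in_G)
      obtain A B where AB: "\<And>i. i \<in> I' \<Longrightarrow> A i \<subseteq> C \<and> B i \<subseteq> F i \<and> B i \<noteq> {} \<and> \<Prod>(A i) * \<Prod>(B i) * w \<in> S ?\<tau>"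
        using common(4) by metis
      \<comment> \<open>One private generator of each relation is given up. Modulo small elements it
        is a word in the core, the common w and the rest of \<open>B i\<close>; putting w into the
        core makes the replacement available to all remaining indices.\<close>
      define b where "b i = (SOME x. x \<in> B i)" for i
      have b: "b i \<in> B i" if "i \<in> I'" for i
        unfolding b_def using AB[OF that] by (simp add: some_in_eq)
      let ?C = "insert w C" and ?F = "\<lambda>i. F i - {b i}"
      have cardF: "card (F i) = Suc (card (?F i))" if "i \<in> I'" for i
        using that b AB Suc.prems(4) common(1) by (metis card_Suc_Diff1 subsetD)
      have cardC: "card ?C \<le> Suc (card C)" using Suc.prems(2) by (simp add: card_insert_if)
      have "covers ?C ?F K (\<sigma> + ?\<tau>) I'"
        unfolding covers_def
      proof (intro ballI)
        fix i h assume ih: "i \<in> I'" "h \<in> K i"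
        have iI: "i \<in> I" using ih common(1) by blast
        have FG: "finite (F i)" "F i \<subseteq> G" using Suc.prems(4)[OF iI] by blast+
        have ABi: "A i \<subseteq> C" "B i \<subseteq> F i" "b i \<in> B i" "\<Prod>(A i) * \<Prod>(B i) * w \<in> S ?\<tau>"
          using AB[OF ih(1)] b[OF ih(1)] by auto
        have beq: "b i = (\<Prod>(A i) * \<Prod>(B i) * w) * (\<Prod>(A i) * \<Prod>(B i - {b i}) * w)"
          by (rule solve_for_factor) (use ABi FG Suc.prems(3) wG finite_subset[OF ABi(2)] in auto)
        let ?X = "?C \<union> ?F i"
        have X: "?X \<subseteq> G" "finite ?X" using Suc.prems(2,3) wG FG by auto
        have "\<Prod>(A i) \<in> sp ?X" "\<Prod>(B i - {b i}) \<in> sp ?X" using ABi by (auto intro!: sp_I)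
        moreover have "w \<in> sp ?X" using sp_I[of "{w}" ?X] by simp
        ultimately have v: "\<Prod>(A i) * \<Prod>(B i - {b i}) * w \<in> sp ?X"
          using X G_square by (intro sp_mult) auto
        show "\<exists>e\<in>S (\<sigma> + ?\<tau>). \<exists>u\<in>sp ?X. h = e * u"
          by (rule eliminate_generator[OF _ _ X _ beq ABi(4) v, where X = "C \<union> F i"])
             (use Suc.prems(2,3,5) ih iI FG in \<open>auto simp: covers_def\<close>)
      qed
      note cov = this
      \<comment> \<open>The measure falls by at least 1, since 2 is lost from \<open>F i\<close> and
        at most 1 is gained in \<open>C\<close>; the bound d survives because the total number of
        generators does not grow.\<close>
      have sizes: "finite (?F i) \<and> ?F i \<subseteq> G \<and> 2 * card (?F i) + card ?C \<le> M \<and> card (?F i) + card ?C \<le> d"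
        if i: "i \<in> I'" for i
        using Suc.prems(4)[OF subsetD[OF common(1) i]] cardF[OF i] cardC by auto
      have "\<exists>J C' F' \<sigma>'. J \<subseteq> I' \<and> card J = k \<and> finite C' \<and> C' \<subseteq> G \<and>
        (\<forall>i\<in>J. finite (F' i) \<and> F' i \<subseteq> G \<and> card (F' i) + card C' \<le> d) \<and>
        covers C' F' K \<sigma>' J \<and> clean C' F' J (a * \<sigma>') \<and> \<sigma> + ?\<tau> \<le> \<sigma>' \<and> \<sigma>' \<le> (a + 1) ^ M * (\<sigma> + ?\<tau>)"
      proof (rule Suc.IH[OF _ _ _ sizes cov Suc.prems(6) common(3)])
        show "finite I'" by (rule finite_subset[OF common(1) Suc.prems(1)])
        show "finite ?C" "?C \<subseteq> G" using Suc.prems(2,3) wG by auto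
      qed
    then show ?thesis
    proof (elim ex_forward)
      fix J C' F' \<sigma>'
      assume *: "J \<subseteq> I' \<and> card J = k \<and> finite C' \<and> C' \<subseteq> G \<and>
        (\<forall>i\<in>J. finite (F' i) \<and> F' i \<subseteq> G \<and> card (F' i) + card C' \<le> d) \<and>
        covers C' F' K \<sigma>' J \<and> clean C' F' J (a * \<sigma>') \<and> \<sigma> + ?\<tau> \<le> \<sigma>' \<and> \<sigma>' \<le> (a + 1) ^ M * (\<sigma> + ?\<tau>)"
      then have "J \<subseteq> I" "\<sigma> \<le> \<sigma>' \<and> \<sigma>' \<le> (a + 1) ^ Suc M * \<sigma>"
        using bound common(1) by blast+
      with * show "J \<subseteq> I \<and> card J = k \<and> finite C' \<and> C' \<subseteq> G \<and>
        (\<forall>i\<in>J. finite (F' i) \<and> F' i \<subseteq> G \<and> card (F' i) + card C' \<le> d) \<and>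
        covers C' F' K \<sigma>' J \<and> clean C' F' J (a * \<sigma>') \<and> \<sigma> \<le> \<sigma>' \<and> \<sigma>' \<le> (a + 1) ^ Suc M * \<sigma>"
        by blast
    qed
    qed
  qed
qed

end

section \<open>Fourier expansions\<close>

text \<open>Splitting on the sign of g gives \<open>f = (1 + g) / 2 * f1 + (1 - g) / 2 * f0\<close>.
  Integer numerators are recorded because the distance from 1/3 rests on them. The sum runs over
  subsets, as different subsets may have the same product.\<close>

lemma fourier_expansion:
  fixes X :: "('x \<Rightarrow> real) set" and \<Gamma> :: "('x \<Rightarrow> real) set \<Rightarrow> bool"
  assumes "finite X" "\<And>g x. g \<in> X \<Longrightarrow> g x = 1 \<or> g x = -1"
  shows "\<exists>a :: ('x \<Rightarrow> real) set \<Rightarrow> int. (\<forall>Y. \<bar>a Y\<bar> \<le> 2 ^ card X) \<and>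
    (\<forall>x. of_bool (\<Gamma> {g\<in>X. g x = 1}) = (\<Sum>Y\<in>Pow X. of_int (a Y) * (\<Prod>Y) x) / 2 ^ card X)"
  using assms
proof (induction X arbitrary: \<Gamma> rule: finite_induct)
  case empty
  show ?case by (intro exI[of _ "\<lambda>_. of_bool (\<Gamma> {})"]) auto
next
  case (insert g X)
  obtain a1 where a1: "\<And>Y. \<bar>a1 Y\<bar> \<le> 2 ^ card X"
    "\<And>x. of_bool (\<Gamma> (insert g {g\<in>X. g x = 1})) = (\<Sum>Y\<in>Pow X. of_int (a1 Y) * (\<Prod>Y) x) / 2 ^ card X"
    using insert.IH[of "\<lambda>Z. \<Gamma> (insert g Z)"] insert.prems by auto
  obtain a0 where a0: "\<And>Y. \<bar>a0 Y\<bar> \<le> 2 ^ card X"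
    "\<And>x. of_bool (\<Gamma> {g\<in>X. g x = 1}) = (\<Sum>Y\<in>Pow X. of_int (a0 Y) * (\<Prod>Y) x) / 2 ^ card X"
    using insert.IH[of \<Gamma>] insert.prems by auto
  \<comment> \<open>Coefficients of \<open>(f1 + f0) / 2\<close> and of
    \<open>g * (f1 - f0) / 2\<close>, with the 2 moved into the denominator.\<close>
  define a where "a Y = (if g \<in> Y then a1 (Y - {g}) - a0 (Y - {g}) else a1 Y + a0 Y)" for Y
  have "\<bar>a Y\<bar> \<le> 2 ^ card (insert g X)" for Y
    using a1(1)[of Y] a0(1)[of Y] a1(1)[of "Y - {g}"] a0(1)[of "Y - {g}"] insert.hyps
    by (auto simp: a_def abs_le_iff)
  moreover have "of_bool (\<Gamma> {h\<in>insert g X. h x = 1}) =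
      (\<Sum>Y\<in>Pow (insert g X). of_int (a Y) * (\<Prod>Y) x) / 2 ^ card (insert g X)" for x
  proof -
    let ?s1 = "\<Sum>Y\<in>Pow X. of_int (a1 Y) * (\<Prod>Y) x" and ?s0 = "\<Sum>Y\<in>Pow X. of_int (a0 Y) * (\<Prod>Y) x"
    have inj: "inj_on (insert g) (Pow X)"
      using insert.hyps(2) by (auto simp: inj_on_def)
    have disj: "Pow X \<inter> insert g ` Pow X = {}" using insert.hyps(2) by auto
    have notin: "g \<notin> Y" "finite Y" if "Y \<in> Pow X" for Y
      using that insert.hyps finite_subset by auto
    have "(\<Sum>Y\<in>Pow (insert g X). of_int (a Y) * (\<Prod>Y) x) =
        (\<Sum>Y\<in>Pow X. of_int (a Y) * (\<Prod>Y) x) + (\<Sum>Y\<in>Pow X. of_int (a (insert g Y)) * (\<Prod>(insert g Y)) x)"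
      unfolding Pow_insert using insert.hyps disj inj
      by (subst sum.union_disjoint) (simp_all add: sum.reindex)
    also have "(\<Sum>Y\<in>Pow X. of_int (a Y) * (\<Prod>Y) x) = ?s1 + ?s0"
      unfolding sum.distrib[symmetric] using notin by (intro sum.cong) (auto simp: a_def algebra_simps)
    also have "(\<Sum>Y\<in>Pow X. of_int (a (insert g Y)) * (\<Prod>(insert g Y)) x) = g x * (?s1 - ?s0)"
      unfolding sum_subtractf[symmetric] sum_distrib_left
    proof (intro sum.cong refl)
      fix Y assume Y: "Y \<in> Pow X"
      then have "insert g Y - {g} = Y" using notin[OF Y] by auto
      then show "of_int (a (insert g Y)) * (\<Prod>(insert g Y)) x =
          g x * (of_int (a1 Y) * (\<Prod>Y) x - of_int (a0 Y) * (\<Prod>Y) x)"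
        using notin[OF Y] by (simp add: a_def algebra_simps)
    qed
    finally have s: "(\<Sum>Y\<in>Pow (insert g X). of_int (a Y) * (\<Prod>Y) x) = ?s1 + ?s0 + g x * (?s1 - ?s0)" .
    have cX: "card (insert g X) = Suc (card X)" using insert.hyps by simp
    have "g x = 1 \<or> g x = -1" using insert.prems by simp
    then show ?thesis
    proof
      assume "g x = 1"
      moreover from this have "{h\<in>insert g X. h x = 1} = insert g {h\<in>X. h x = 1}" by auto
      ultimately show ?thesis unfolding s cX using a1(2)[of x] by simp
    next
      assume g1: "g x = -1"
      then have "{h\<in>insert g X. h x = 1} = {h\<in>X. h x = 1}" by auto
      then show ?thesis unfolding s cX using a0(2)[of x] g1 by simp
    qed
  qed
  ultimately show ?case by blast
qed

text \<open>A linear combination of elements of \<open>T\<close> whose coefficients have absolute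
  sum at most \<open>K\<close>. The slack in the base clause makes \<open>K\<close> an upper bound
  instead of an exact sum.\<close>

inductive comb :: "('x \<Rightarrow> real) set \<Rightarrow> real \<Rightarrow> ('x \<Rightarrow> real) \<Rightarrow> bool" for T where
  comb_0: "0 \<le> K \<Longrightarrow> comb T K (\<lambda>_. 0)"
| comb_step: "t \<in> T \<Longrightarrow> comb T K \<phi> \<Longrightarrow> comb T (\<bar>c\<bar> + K) (\<lambda>x. c * t x + \<phi> x)"

lemma comb_mono: "comb T K \<phi> \<Longrightarrow> K \<le> L \<Longrightarrow> comb T L \<phi>"
proof (induction arbitrary: L rule: comb.induct)
  case (comb_step t K \<phi> c)
  then have "comb T (\<bar>c\<bar> + (L - \<bar>c\<bar>)) (\<lambda>x. c * t x + \<phi> x)"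
    by (intro comb.comb_step) auto
  then show ?case by simp
qed (auto intro: comb.comb_0)

lemma comb_single: "t \<in> T \<Longrightarrow> \<bar>c\<bar> \<le> K \<Longrightarrow> comb T K (\<lambda>x. c * t x)"
  using comb_step[OF _ comb_0[of 0], of t T c] by (auto intro: comb_mono)

lemma comb_add: "comb T K \<phi> \<Longrightarrow> comb T L \<psi> \<Longrightarrow> comb T (K + L) (\<lambda>x. \<phi> x + \<psi> x)"
proof (induction rule: comb.induct)
  case (comb_0 K)
  then show ?case by (auto intro: comb_mono)
next
  case (comb_step t K \<phi> c)
  then show ?case using comb.comb_step[of t T "K + L" "\<lambda>x. \<phi> x + \<psi> x" c] by (simp add: add.assoc)
qed

lemma comb_sum:
  assumes "finite A" "\<And>a. a \<in> A \<Longrightarrow> comb T (K a) (\<phi> a)"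
  shows "comb T (\<Sum>a\<in>A. K a) (\<lambda>x. \<Sum>a\<in>A. \<phi> a x)"
  using assms by (induction A rule: finite_induct) (auto intro: comb_0 comb_add)

lemma comb_mult_single:
  assumes "comb U L \<psi>" "\<And>u. u \<in> U \<Longrightarrow> t * u \<in> V"
  shows "comb V (\<bar>c\<bar> * L) (\<lambda>x. c * t x * \<psi> x)"
  using assms
proof (induction rule: comb.induct)
  case (comb_0 K)
  then show ?case by (auto intro: comb.comb_0)
next
  case (comb_step u K \<phi> e)
  then have "comb V (\<bar>c * e\<bar> + \<bar>c\<bar> * K) (\<lambda>x. (c * e) * (t * u) x + c * t x * \<phi> x)"
    by (intro comb.comb_step) auto
  then show ?case by (simp add: algebra_simps abs_mult)
qed

lemma comb_nonneg: "comb T K \<phi> \<Longrightarrow> 0 \<le> K"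
  by (induction rule: comb.induct) auto

lemma comb_mult:
  assumes "comb T K \<phi>" "comb U L \<psi>" "\<And>t u. t \<in> T \<Longrightarrow> u \<in> U \<Longrightarrow> t * u \<in> V"
  shows "comb V (K * L) (\<lambda>x. \<phi> x * \<psi> x)"
  using assms(1)
proof (induction rule: comb.induct)
  case (comb_0 K)
  then show ?case using comb_nonneg[OF assms(2)] by (auto intro: comb.comb_0)
next
  case (comb_step t K \<phi> c)
  have "comb V (\<bar>c\<bar> * L) (\<lambda>x. c * t x * \<psi> x)"
    using comb_step assms by (intro comb_mult_single) auto
  from comb_add[OF this comb_step.IH] show ?case by (simp add: algebra_simps)
qed

lemma comb_sum_bound:
  assumes "comb T K \<phi>" "\<And>t. t \<in> T \<Longrightarrow> \<bar>\<Sum>x\<in>A. t x\<bar> \<le> e" "0 \<le> e"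
  shows "\<bar>\<Sum>x\<in>A. \<phi> x\<bar> \<le> K * e"
  using assms(1)
proof (induction rule: comb.induct)
  case (comb_0 K)
  then show ?case using assms by simp
next
  case (comb_step t K \<phi> c)
  have "\<bar>\<Sum>x\<in>A. c * t x + \<phi> x\<bar> = \<bar>c * (\<Sum>x\<in>A. t x) + (\<Sum>x\<in>A. \<phi> x)\<bar>"
    by (simp add: sum.distrib sum_distrib_left)
  also have "\<dots> \<le> \<bar>c\<bar> * \<bar>\<Sum>x\<in>A. t x\<bar> + \<bar>\<Sum>x\<in>A. \<phi> x\<bar>"
    using abs_triangle_ineq[of "c * (\<Sum>x\<in>A. t x)"] by (simp add: abs_mult)
  also have "\<dots> \<le> \<bar>c\<bar> * e + K * e"
    using comb_step assms by (intro add_mono mult_left_mono) auto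
  finally show ?case by (simp add: algebra_simps)
qed

lemma comb_bound:
  assumes "comb T K \<phi>" "\<And>t. t \<in> T \<Longrightarrow> \<bar>t x\<bar> \<le> 1"
  shows "\<bar>\<phi> x\<bar> \<le> K"
  using comb_sum_bound[OF assms(1), of "{x}" 1] assms(2) by simp

lemma Prod_sign:
  fixes Y :: "('x \<Rightarrow> real) set"
  assumes "\<And>g. g \<in> Y \<Longrightarrow> g x = 1 \<or> g x = -1"
  shows "(\<Prod>Y) x = 1 \<or> (\<Prod>Y) x = -1"
proof (cases "finite Y")
  case True
  then show ?thesis using assms
  proof (induction Y rule: finite_induct)
    case (insert g Y)
    then have "g x = 1 \<or> g x = -1" "(\<Prod>Y) x = 1 \<or> (\<Prod>Y) x = -1" by auto
    then show ?case using insert.hyps by auto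
  qed simp
qed simp

section \<open>Product Bernoulli measures and total variation\<close>

lemma sum_cube_prod:
  fixes \<phi> :: "nat \<Rightarrow> bool \<Rightarrow> real"
  shows "(\<Sum>y\<in>cube n. \<Prod>i<n. \<phi> i (y i)) = (\<Prod>i<n. \<phi> i True + \<phi> i False)"
proof (induction n)
  case 0
  then show ?case by (simp add: cube_0)
next
  case (Suc n)
  have "(\<Sum>y\<in>cube (Suc n). \<Prod>i<Suc n. \<phi> i (y i)) =
      (\<Sum>y\<in>cube n. \<Prod>i<Suc n. \<phi> i (y i)) + (\<Sum>y\<in>cube n. \<Prod>i<Suc n. \<phi> i ((y(n := True)) i))"
    unfolding cube_Suc using cube_Suc_disjoint inj_on_cube_upd
    by (subst sum.union_disjoint) (simp_all add: sum.reindex)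
  also have "(\<Sum>y\<in>cube n. \<Prod>i<Suc n. \<phi> i (y i)) = (\<Sum>y\<in>cube n. \<Prod>i<n. \<phi> i (y i)) * \<phi> n False"
    unfolding sum_distrib_right by (intro sum.cong) (auto simp: cube_def)
  also have "(\<Sum>y\<in>cube n. \<Prod>i<Suc n. \<phi> i ((y(n := True)) i)) = (\<Sum>y\<in>cube n. \<Prod>i<n. \<phi> i (y i)) * \<phi> n True"
    unfolding sum_distrib_right by (intro sum.cong) auto
  finally show ?case by (simp add: Suc.IH algebra_simps)
qed

lemma ber_prod_eq_prod: "ber_prod n p y = (\<Prod>i<n. if y i then p else 1 - p)"
proof -
  have "card {i. i < n \<and> \<not> y i} = n - card {i. i < n \<and> y i}"
  proof -
    have "{i. i < n \<and> \<not> y i} = {..<n} - {i. i < n \<and> y i}" by auto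
    then show ?thesis by (simp add: card_Diff_subset subset_iff)
  qed
  moreover have "{..<n} \<inter> {i. y i} = {i. i < n \<and> y i}" "{..<n} \<inter> - {i. y i} = {i. i < n \<and> \<not> y i}"
    by auto
  ultimately show ?thesis by (simp add: prod.If_cases ber_prod_def)
qed

lemma ber_prod_expectation:
  fixes \<psi> :: "nat \<Rightarrow> bool \<Rightarrow> real"
  shows "(\<Sum>y\<in>cube n. ber_prod n p y * (\<Prod>i<n. \<psi> i (y i))) = (\<Prod>i<n. p * \<psi> i True + (1 - p) * \<psi> i False)"
proof -
  have "(\<Sum>y\<in>cube n. ber_prod n p y * (\<Prod>i<n. \<psi> i (y i))) =
      (\<Sum>y\<in>cube n. \<Prod>i<n. (\<lambda>b. (if b then p else 1 - p) * \<psi> i b) (y i))"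
    by (simp add: ber_prod_eq_prod prod.distrib)
  also have "\<dots> = (\<Prod>i<n. p * \<psi> i True + (1 - p) * \<psi> i False)"
    by (subst sum_cube_prod) simp
  finally show ?thesis .
qed

lemma ber_prod_total: "(\<Sum>y\<in>cube n. ber_prod n p y) = 1"
  using ber_prod_expectation[of n p "\<lambda>_ _. 1"] by simp

lemma ber_prod_nonneg: "0 \<le> p \<Longrightarrow> p \<le> 1 \<Longrightarrow> 0 \<le> ber_prod n p y"
  by (simp add: ber_prod_def)

lemma ber_prod_covariance:
  assumes "i < n" "j < n"
  shows "(\<Sum>y\<in>cube n. ber_prod n p y * ((of_bool (y i) - p) * (of_bool (y j) - p))) =
    (if i = j then p * (1 - p) else (0::real))"
proof -
  \<comment> \<open>The two centred factors are placed at coordinates i and j, with 1 elsewhere; for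
    \<open>i = j\<close> both land in the same place and give the variance.\<close>
  define \<psi> where "\<psi> l b = (if l = i then of_bool b - p else 1) * (if l = j then of_bool b - p else (1::real))" for l b
  have "(\<Prod>l<n. \<psi> l (y l)) = (of_bool (y i) - p) * (of_bool (y j) - p)" for y
    using assms by (simp add: \<psi>_def prod.distrib prod.delta)
  then have "(\<Sum>y\<in>cube n. ber_prod n p y * ((of_bool (y i) - p) * (of_bool (y j) - p))) =
      (\<Prod>l<n. p * \<psi> l True + (1 - p) * \<psi> l False)"
    using ber_prod_expectation[of n p \<psi>] by simp
  also have "\<dots> = (if i = j then p * (1 - p) else 0)"
  proof (cases "i = j")
    case True
    have "(\<Prod>l<n. p * \<psi> l True + (1 - p) * \<psi> l False) = (\<Prod>l<n. if l = i then p * (1 - p) else 1)"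
      using True by (intro prod.cong) (auto simp: \<psi>_def algebra_simps)
    then show ?thesis using True assms by (simp add: prod.delta)
  next
    case False
    have "p * \<psi> i True + (1 - p) * \<psi> i False = 0" using False by (simp add: \<psi>_def algebra_simps)
    then show ?thesis using False assms by (auto intro: prod_zero)
  qed
  finally show ?thesis .
qed

lemma ber_prod_second_moment:
  assumes "J \<subseteq> {..<n}"
  shows "(\<Sum>y\<in>cube n. ber_prod n p y * (\<Sum>i\<in>J. w i * (of_bool (y i) - p))\<^sup>2) =
    p * (1 - p) * (\<Sum>i\<in>J. (w i)\<^sup>2 :: real)"
proof -
  have fin: "finite J" using assms finite_subset by blast
  have "(\<Sum>y\<in>cube n. ber_prod n p y * (\<Sum>i\<in>J. w i * (of_bool (y i) - p))\<^sup>2) =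
     (\<Sum>y\<in>cube n. \<Sum>i\<in>J. \<Sum>j\<in>J. w i * w j * (ber_prod n p y * ((of_bool (y i) - p) * (of_bool (y j) - p))))"
    by (simp add: power2_eq_square sum_product sum_distrib_left mult_ac)
  also have "\<dots> = (\<Sum>i\<in>J. \<Sum>j\<in>J. w i * w j *
      (\<Sum>y\<in>cube n. ber_prod n p y * ((of_bool (y i) - p) * (of_bool (y j) - p))))"
    unfolding sum_distrib_left
    by (subst sum.swap) (intro sum.cong refl, subst sum.swap, rule refl)
  also have "\<dots> = (\<Sum>i\<in>J. \<Sum>j\<in>J. if i = j then w i * w j * (p * (1 - p)) else 0)"
    using assms by (intro sum.cong refl) (subst ber_prod_covariance, auto)
  also have "\<dots> = (\<Sum>i\<in>J. w i * w i * (p * (1 - p)))"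
    using fin by (simp add: sum.delta')
  finally show ?thesis by (simp add: power2_eq_square sum_distrib_left mult_ac)
qed

text \<open>Chebyshev's inequality, with the weights replaced by their bound \<open>K\<close> in the
  variance.\<close>

lemma ber_prod_tail:
  assumes J: "J \<subseteq> {..<n}" and w: "\<And>i. i \<in> J \<Longrightarrow> \<bar>w i\<bar> \<le> K" and p: "0 \<le> p" "p \<le> 1" and \<theta>: "0 < \<theta>"
  shows "(\<Sum>y | y \<in> cube n \<and> \<theta> \<le> (\<Sum>i\<in>J. w i * (of_bool (y i) - p)). ber_prod n p y)
    \<le> p * (1 - p) * (real (card J) * K\<^sup>2) / \<theta>\<^sup>2"
proof -
  let ?W = "\<lambda>y. \<Sum>i\<in>J. w i * (of_bool (y i) - p)"
  have "(\<Sum>y | y \<in> cube n \<and> \<theta> \<le> ?W y. ber_prod n p y) * \<theta>\<^sup>2 =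
      (\<Sum>y | y \<in> cube n \<and> \<theta> \<le> ?W y. ber_prod n p y * \<theta>\<^sup>2)" by (simp add: sum_distrib_right)
  also have "\<dots> \<le> (\<Sum>y | y \<in> cube n \<and> \<theta> \<le> ?W y. ber_prod n p y * (?W y)\<^sup>2)"
    using \<theta> p by (intro sum_mono mult_left_mono power_mono ber_prod_nonneg) auto
  also have "\<dots> \<le> (\<Sum>y\<in>cube n. ber_prod n p y * (?W y)\<^sup>2)"
    using p by (intro sum_mono2) (auto intro!: mult_nonneg_nonneg ber_prod_nonneg)
  also have "\<dots> = p * (1 - p) * (\<Sum>i\<in>J. (w i)\<^sup>2)" by (rule ber_prod_second_moment[OF J])
  also have "\<dots> \<le> p * (1 - p) * (\<Sum>i\<in>J. K\<^sup>2)"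
  proof (intro mult_left_mono sum_mono)
    fix i assume "i \<in> J"
    then show "(w i)\<^sup>2 \<le> K\<^sup>2" using w[of i] by (simp add: abs_le_square_iff[symmetric])
  qed (use p in auto)
  finally show ?thesis using \<theta> by (simp add: field_simps)
qed

lemma tv_dist_ge:
  assumes "A \<subseteq> cube n" "(\<Sum>y\<in>cube n. D1 y) = 1" "(\<Sum>y\<in>cube n. D2 y) = 1"
  shows "(\<Sum>y\<in>A. D1 y) - (\<Sum>y\<in>A. D2 y) \<le> tv_dist n D1 D2"
proof -
  have split: "(\<Sum>y\<in>cube n. f y) = (\<Sum>y\<in>A. f y) + (\<Sum>y\<in>cube n - A. f y)" for f :: "_ \<Rightarrow> real"
    using assms(1) by (metis add.commute finite_cube sum.subset_diff)
  have "(\<Sum>y\<in>A. D1 y - D2 y) \<le> (\<Sum>y\<in>A. \<bar>D1 y - D2 y\<bar>)"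
    "(\<Sum>y\<in>cube n - A. D2 y - D1 y) \<le> (\<Sum>y\<in>cube n - A. \<bar>D1 y - D2 y\<bar>)"
    by (intro sum_mono; simp)+
  then have "2 * ((\<Sum>y\<in>A. D1 y) - (\<Sum>y\<in>A. D2 y)) \<le> (\<Sum>y\<in>cube n. \<bar>D1 y - D2 y\<bar>)"
    using split[of "\<lambda>y. \<bar>D1 y - D2 y\<bar>"] split[of D1] split[of D2] assms
    by (simp add: sum_subtractf)
  then show ?thesis by (simp add: tv_dist_def)
qed

lemma distP_event:
  assumes "A \<subseteq> cube n"
  shows "(\<Sum>y\<in>A. distP m n P y) = real (card {x\<in>cube m. (\<lambda>i. i < n \<and> P i x) \<in> A}) / 2 ^ m"
proof -
  have fA: "finite A" using assms finite_cube finite_subset by blast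
  have eq: "{x\<in>cube m. \<forall>i<n. P i x = y i} = {x\<in>cube m. (\<lambda>i. i < n \<and> P i x) = y}" if "y \<in> A" for y
    using that assms by (auto simp: cube_def fun_eq_iff not_less[symmetric] subset_iff)
  have "real (card {x\<in>cube m. (\<lambda>i. i < n \<and> P i x) \<in> A}) =
      real (card (\<Union>y\<in>A. {x\<in>cube m. (\<lambda>i. i < n \<and> P i x) = y}))"
    by (intro arg_cong[of _ _ "\<lambda>A. real (card A)"]) auto
  also have "\<dots> = (\<Sum>y\<in>A. real (card {x\<in>cube m. (\<lambda>i. i < n \<and> P i x) = y}))"
    using fA by (subst card_UN_disjoint) auto
  finally show ?thesis unfolding distP_def using eq by (simp add: sum_divide_distrib)
qed

lemma distP_total: "(\<Sum>y\<in>cube n. distP m n P y) = 1"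
proof -
  have "{x\<in>cube m. (\<lambda>i. i < n \<and> P i x) \<in> cube n} = cube m" by (auto simp: cube_def)
  then show ?thesis by (simp add: distP_event card_cube)
qed

section \<open>The separating statistic\<close>

lemma Prod_apply: "(\<Prod>Y) x = (\<Prod>g\<in>Y. g x)" for Y :: "('x \<Rightarrow> real) set"
  by (induction Y rule: infinite_finite_induct) auto

text \<open>The integer \<open>3 * z - 2 ^ c\<close> is nonzero because 3 does not divide a power of
  2. This is the point at which the value 1/3 matters.\<close>

lemma dyadic_far_from_third:
  fixes z :: int
  shows "1 / (3 * 2 ^ c) \<le> \<bar>of_int z / 2 ^ c - 1 / 3 :: real\<bar>"
proof -
  have "\<not> 3 dvd (2 ^ c :: int)"
  proof
    assume "3 dvd (2 ^ c :: int)"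
    moreover have "coprime (3::int) (2 ^ c)" by (simp add: coprime_power_right_iff)
    ultimately have "is_unit (3::int)" by (metis coprime_absorb_left)
    then show False by simp
  qed
  then have "3 * z - 2 ^ c \<noteq> 0" by (metis dvd_triv_left eq_iff_diff_eq_0)
  then have "1 \<le> \<bar>3 * z - 2 ^ c\<bar>" by linarith
  then have "of_int 1 \<le> (of_int \<bar>3 * z - 2 ^ c\<bar> :: real)" by (simp only: of_int_le_iff)
  then have "(1::real) \<le> \<bar>3 * of_int z - 2 ^ c\<bar>" by simp
  moreover have "of_int z / 2 ^ c - 1 / 3 = (3 * of_int z - 2 ^ c) / (3 * 2 ^ c :: real)"
    by (simp add: field_simps)
  ultimately show ?thesis by (simp add: divide_right_mono)
qed

text \<open>Each coefficient is at most 1 in absolute value after division by b, so the number of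
  terms bounds the coefficient sum.\<close>

lemma comb_expansion:
  fixes \<A> :: "('x \<Rightarrow> real) set set"
  assumes "finite \<A>" "card \<A> \<le> L" "\<And>Y. \<bar>a Y\<bar> \<le> b" "0 < b" "\<And>Y. Y \<in> \<A> \<Longrightarrow> \<Prod>Y \<in> T"
  shows "comb T (real L) (\<lambda>x. (\<Sum>Y\<in>\<A>. a Y * (\<Prod>Y) x) / b)"
proof -
  have "comb T (\<Sum>Y\<in>\<A>. 1) (\<lambda>x. \<Sum>Y\<in>\<A>. (a Y / b) * (\<Prod>Y) x)"
    using assms by (intro comb_sum comb_single) auto
  then have "comb T (real L) (\<lambda>x. \<Sum>Y\<in>\<A>. (a Y / b) * (\<Prod>Y) x)"
    by (rule comb_mono) (use assms in simp)
  then show ?thesis by (simp add: sum_divide_distrib)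
qed

text \<open>Here \<open>w + 1 / 3\<close> is the part of the Fourier expansion of \<open>P\<close> that is supported on the core \<open>X0\<close>.\<close>

lemma conditional_decomposition:
  assumes fin: "finite X" "card X \<le> d" and sub: "X0 \<subseteq> X"
    and sgn: "\<And>g x. g \<in> X \<Longrightarrow> g x = 1 \<or> g x = -1"
    and det: "determined m X P"
  shows "\<exists>w N. (\<forall>x\<in>cube m. of_bool (P x) - 1 / 3 = w x + N x) \<and>
    (\<forall>x. 1 / (3 * 2 ^ d) \<le> \<bar>w x\<bar> \<and> \<bar>w x\<bar> \<le> 2 ^ (d + 1)) \<and>
    (\<forall>x y. (\<forall>g\<in>X0. g x = g y) \<longrightarrow> w x = w y) \<and>
    comb {\<Prod>Y |Y. Y \<subseteq> X \<and> \<not> Y \<subseteq> X0} (2 ^ (2 * d + 1)) (\<lambda>x. w x * N x)"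
proof -
  \<comment> \<open>The outer function on sign patterns; the existential assigns False to patterns
    that no point realises.\<close>
  define \<Gamma> where "\<Gamma> Z \<longleftrightarrow> (\<exists>x\<in>cube m. {g\<in>X. g x = 1} = Z \<and> P x)" for Z
  have \<Gamma>: "\<Gamma> {g\<in>X. g x = 1} = P x" if x: "x \<in> cube m" for x
  proof -
    have agree: "P y = P x" if y: "y \<in> cube m" "{g\<in>X. g y = 1} = {g\<in>X. g x = 1}" for y
    proof -
      have "g y = g x" if g: "g \<in> X" for g
      proof -
        have "g \<in> {g\<in>X. g y = 1} \<longleftrightarrow> g \<in> {g\<in>X. g x = 1}" using y(2) by (rule arg_cong)
        then have "g y = 1 \<longleftrightarrow> g x = 1" using g by simp
        then show ?thesis using sgn[OF g, of x] sgn[OF g, of y] by metis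
      qed
      then show ?thesis using det x y(1) unfolding determined_def by metis
    qed
    show ?thesis
    proof
      assume "\<Gamma> {g\<in>X. g x = 1}"
      then obtain y where "y \<in> cube m" "{g\<in>X. g y = 1} = {g\<in>X. g x = 1}" "P y"
        unfolding \<Gamma>_def by (elim bexE conjE) (rule that)
      then show "P x" using agree by simp
    next
      assume "P x"
      then show "\<Gamma> {g\<in>X. g x = 1}" using x unfolding \<Gamma>_def by (intro bexI[of _ x] conjI refl)
    qed
  qed
  have "\<exists>a :: _ \<Rightarrow> int. (\<forall>Y. \<bar>a Y\<bar> \<le> 2 ^ card X) \<and>
    (\<forall>x. of_bool (\<Gamma> {g\<in>X. g x = 1}) = (\<Sum>Y\<in>Pow X. of_int (a Y) * (\<Prod>Y) x) / 2 ^ card X)"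
    by (rule fourier_expansion[OF fin(1)]) (rule sgn)
  then obtain a :: "_ \<Rightarrow> int" where a: "\<And>Y. \<bar>a Y\<bar> \<le> 2 ^ card X"
    "\<And>x. of_bool (\<Gamma> {g\<in>X. g x = 1}) = (\<Sum>Y\<in>Pow X. of_int (a Y) * (\<Prod>Y) x) / 2 ^ card X"
    by (elim exE conjE) (rule that, simp_all)
  have a': "\<bar>of_int (a Y) :: real\<bar> \<le> 2 ^ card X" for Y
  proof -
    have "(of_int \<bar>a Y\<bar> :: real) \<le> of_int (2 ^ card X)" using a(1)[of Y] by (simp only: of_int_le_iff)
    then show ?thesis by simp
  qed
  have finX0: "finite X0" using fin sub finite_subset by blast
  define M where "M x = (\<Sum>Y\<in>Pow X0. of_int (a Y) * (\<Prod>Y) x) / (2 ^ card X :: real)" for x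
  define N where "N x = (\<Sum>Y\<in>Pow X - Pow X0. of_int (a Y) * (\<Prod>Y) x) / (2 ^ card X :: real)" for x
  define w where "w x = M x - 1 / 3" for x
  let ?T = "{\<Prod>Y |Y. Y \<subseteq> X \<and> \<not> Y \<subseteq> X0}"
  have pow: "card (Pow X) \<le> 2 ^ d" "card (Pow X0) \<le> 2 ^ d"
    using fin card_mono[OF fin(1) sub] by (simp_all add: card_Pow finX0)
  have eq: "of_bool (P x) - 1 / 3 = w x + N x" if "x \<in> cube m" for x
  proof -
    have "of_bool (P x) = M x + N x"
      using a(2)[of x] \<Gamma>[OF that] sub fin
      by (simp add: M_def N_def add_divide_distrib[symmetric] sum.subset_diff[of "Pow X0" "Pow X"] Pow_mono add.commute)
    then show ?thesis by (simp add: w_def)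
  qed
  \<comment> \<open>At each x the core sum is an integer, as its coefficients are integers and its
    words are signs.\<close>
  have low: "1 / (3 * 2 ^ d) \<le> \<bar>w x\<bar>" for x
  proof -
    have "of_int (a Y) * (\<Prod>Y) x \<in> \<int>" if "Y \<in> Pow X0" for Y
    proof -
      have "(\<Prod>Y) x = 1 \<or> (\<Prod>Y) x = -1" using that sub by (intro Prod_sign sgn) auto
      then show ?thesis by auto
    qed
    then have "(\<Sum>Y\<in>Pow X0. of_int (a Y) * (\<Prod>Y) x) \<in> \<int>" by (rule Ints_sum)
    then obtain z where z: "(\<Sum>Y\<in>Pow X0. of_int (a Y) * (\<Prod>Y) x) = of_int z" by (elim Ints_cases)
    have "1 / (3 * 2 ^ d) \<le> 1 / (3 * 2 ^ card X :: real)"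
      using fin by (intro divide_left_mono mult_left_mono power_increasing) auto
    also have "\<dots> \<le> \<bar>w x\<bar>" unfolding w_def M_def z by (rule dyadic_far_from_third)
    finally show ?thesis .
  qed
  have combM: "comb (sp X0) (real (2 ^ d)) M"
    unfolding M_def using pow finX0 a' by (intro comb_expansion) (auto intro: sp_I)
  have one: "1 \<in> sp X0" using sp_I[of "{}" X0] by simp
  have "comb (sp X0) (real (2 ^ d) + 1 / 3) (\<lambda>x. M x + (- 1 / 3) * 1 x)"
    by (rule comb_add[OF combM comb_single[OF one]]) simp
  moreover have "(\<lambda>x. M x + (- 1 / 3) * (1 :: _ \<Rightarrow> real) x) = w" by (simp add: w_def fun_eq_iff)
  moreover have "real (2 ^ d) + 1 / 3 \<le> 2 ^ (d + 1)"
  proof -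
    have "(1::real) \<le> 2 ^ d" by simp
    then show ?thesis unfolding of_nat_power of_nat_numeral power_add power_one_right by linarith
  qed
  ultimately have combw: "comb (sp X0) (2 ^ (d + 1)) w" using comb_mono by metis
  have combN: "comb ?T (real (2 ^ d)) N"
  proof -
    have "card (Pow X - Pow X0) \<le> 2 ^ d"
      using pow(1) card_mono[of "Pow X" "Pow X - Pow X0"] fin by fastforce
    then show ?thesis
      unfolding N_def using fin a' by (intro comb_expansion) auto
  qed
  \<comment> \<open>A core word times a word leaving the core is the word of the symmetric
    difference, which still contains the generator outside \<open>X0\<close>. Hence weighting by w
    keeps \<open>N\<close> free of pure core words.\<close>
  have "comb ?T (2 ^ (d + 1) * real (2 ^ d)) (\<lambda>x. w x * N x)"
  proof (rule comb_mult[OF combw combN])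
    fix t u assume "t \<in> sp X0" "u \<in> ?T"
    then obtain U Y where U: "U \<subseteq> X0" "t = \<Prod>U" and Y: "Y \<subseteq> X" "\<not> Y \<subseteq> X0" "u = \<Prod>Y"
      by (auto simp: sp_def)
    have sq: "g * g = 1" if "g \<in> X" for g
    proof
      fix x show "(g * g) x = 1 x" using sgn[OF that, of x] by auto
    qed
    have fUY: "finite U" "finite Y" by (rule finite_subset[OF U(1) finX0], rule finite_subset[OF Y(1) fin(1)])
    have "\<Prod>U * \<Prod>Y = \<Prod>((U - Y) \<union> (Y - U))"
      by (rule prod_sym_diff[OF fUY]) (rule sq, use Y in auto)
    then have "t * u = \<Prod>((U - Y) \<union> (Y - U))" by (simp only: U Y)
    moreover have "(U - Y) \<union> (Y - U) \<subseteq> X" using U(1) Y(1) sub by blast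
    moreover have "\<not> (U - Y) \<union> (Y - U) \<subseteq> X0" using U(1) Y(2) by blast
    ultimately show "t * u \<in> ?T" by (intro CollectI exI[of _ "(U - Y) \<union> (Y - U)"] conjI)
  qed
  moreover have "(2::real) ^ (d + 1) * real (2 ^ d) = 2 ^ (2 * d + 1)"
  proof -
    have "(2::real) ^ (d + 1) * real (2 ^ d) = 2 ^ (d + 1 + d)" by (simp only: power_add of_nat_power of_nat_numeral)
    also have "d + 1 + d = 2 * d + 1" by simp
    finally show ?thesis .
  qed
  ultimately have combwN: "comb ?T (2 ^ (2 * d + 1)) (\<lambda>x. w x * N x)" by (simp only:)
  have up: "\<bar>w x\<bar> \<le> 2 ^ (d + 1)" for x
  proof (rule comb_bound[OF combw])
    fix t assume "t \<in> sp X0"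
    then obtain U where U: "U \<subseteq> X0" "t = \<Prod>U" by (auto simp: sp_def)
    have "(\<Prod>U) x = 1 \<or> (\<Prod>U) x = -1" using U sub by (intro Prod_sign sgn) auto
    then show "\<bar>t x\<bar> \<le> 1" using U by auto
  qed
  have dep: "w x = w y" if "\<forall>g\<in>X0. g x = g y" for x y
  proof -
    have "(\<Prod>Y) x = (\<Prod>Y) y" if "Y \<in> Pow X0" for Y
      unfolding Prod_apply using that \<open>\<forall>g\<in>X0. g x = g y\<close> by (intro prod.cong) auto
    then show ?thesis by (simp add: w_def M_def)
  qed
  show ?thesis
    using eq low up dep combwN by (intro exI[of _ w] exI[of _ N] conjI allI ballI impI) simp_all
qed

text \<open>Write \<open>of_bool (P i x) - 1/3 = w i x + N i x\<close>. On a sample the statistic is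
  the sum of the \<open>(w i x)^2\<close>, bounded below at every point, plus a noise term whose
  second moment is controlled by \<open>corr\<close>. The loss \<open>2 ^ (8 * d)\<close> is that of
  the noise, from coefficient sums against the lower bound on the weights; the Bernoulli side, with
  its at most \<open>2 ^ d\<close> core patterns, costs only \<open>2 ^ (7 * d)\<close>.\<close>

theorem tv_dist_of_uncorrelated:
  fixes P :: "nat \<Rightarrow> (nat \<Rightarrow> bool) \<Rightarrow> bool"
  assumes J: "J \<subseteq> {..<n}" "0 < card J" and X0: "finite X0" and B: "\<And>i. i \<in> J \<Longrightarrow> finite (B i)"
    and d: "\<And>i. i \<in> J \<Longrightarrow> card (X0 \<union> B i) \<le> d"
    and sgn: "\<And>g x i. i \<in> J \<Longrightarrow> g \<in> X0 \<union> B i \<Longrightarrow> g x = 1 \<or> g x = -1"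
    and det: "\<And>i. i \<in> J \<Longrightarrow> determined m (X0 \<union> B i) (P i)"
    and \<epsilon>: "0 \<le> \<epsilon>"
    and corr: "\<And>i j Y Y'. i \<in> J \<Longrightarrow> j \<in> J \<Longrightarrow> i \<noteq> j \<Longrightarrow> Y \<subseteq> X0 \<union> B i \<Longrightarrow> \<not> Y \<subseteq> X0 \<Longrightarrow>
       Y' \<subseteq> X0 \<union> B j \<Longrightarrow> \<not> Y' \<subseteq> X0 \<Longrightarrow> \<bar>\<Sum>x\<in>cube m. (\<Prod>Y * \<Prod>Y') x\<bar> \<le> \<epsilon> * 2 ^ m"
  shows "1 - 2 ^ (11 + 8 * d) * (1 / real (card J) + \<epsilon>) \<le> tv_dist n (distP m n P) (ber_prod n (1 / 3))"
proof -
  let ?T = "\<lambda>i. {\<Prod>Y |Y. Y \<subseteq> X0 \<union> B i \<and> \<not> Y \<subseteq> X0}"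
  let ?K = "2 ^ (2 * d + 1) :: real"
  have "\<forall>i\<in>J. \<exists>w N. (\<forall>x\<in>cube m. of_bool (P i x) - 1 / 3 = w x + N x) \<and>
    (\<forall>x. 1 / (3 * 2 ^ d) \<le> \<bar>w x\<bar> \<and> \<bar>w x\<bar> \<le> 2 ^ (d + 1)) \<and>
    (\<forall>x y. (\<forall>g\<in>X0. g x = g y) \<longrightarrow> w x = w y) \<and> comb (?T i) ?K (\<lambda>x. w x * N x)"
  proof
    fix i assume i: "i \<in> J"
    show "\<exists>w N. (\<forall>x\<in>cube m. of_bool (P i x) - 1 / 3 = w x + N x) \<and>
      (\<forall>x. 1 / (3 * 2 ^ d) \<le> \<bar>w x\<bar> \<and> \<bar>w x\<bar> \<le> 2 ^ (d + 1)) \<and>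
      (\<forall>x y. (\<forall>g\<in>X0. g x = g y) \<longrightarrow> w x = w y) \<and> comb (?T i) ?K (\<lambda>x. w x * N x)"
      by (rule conditional_decomposition) (use X0 B[OF i] d[OF i] sgn[OF i] det[OF i] in auto)
  qed
  from bchoice[OF this] obtain w where
    "\<forall>i\<in>J. \<exists>N. (\<forall>x\<in>cube m. of_bool (P i x) - 1 / 3 = w i x + N x) \<and>
    (\<forall>x. 1 / (3 * 2 ^ d) \<le> \<bar>w i x\<bar> \<and> \<bar>w i x\<bar> \<le> 2 ^ (d + 1)) \<and>
    (\<forall>x y. (\<forall>g\<in>X0. g x = g y) \<longrightarrow> w i x = w i y) \<and> comb (?T i) ?K (\<lambda>x. w i x * N x)"
    by (elim exE) (rule that)
  from bchoice[OF this] obtain N where wN: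
    "\<forall>i\<in>J. (\<forall>x\<in>cube m. of_bool (P i x) - 1 / 3 = w i x + N i x) \<and>
    (\<forall>x. 1 / (3 * 2 ^ d) \<le> \<bar>w i x\<bar> \<and> \<bar>w i x\<bar> \<le> 2 ^ (d + 1)) \<and>
    (\<forall>x y. (\<forall>g\<in>X0. g x = g y) \<longrightarrow> w i x = w i y) \<and> comb (?T i) ?K (\<lambda>x. w i x * N i x)"
    by (elim exE) (rule that)
  have eq: "of_bool (P i x) - 1 / 3 = w i x + N i x" if "i \<in> J" "x \<in> cube m" for i x
    using wN that by simp
  have low: "1 / (3 * 2 ^ d) \<le> \<bar>w i x\<bar>" and up: "\<bar>w i x\<bar> \<le> 2 ^ (d + 1)" if "i \<in> J" for i x
    using wN that by simp_all
  have dep: "w i x = w i y" if "i \<in> J" "\<forall>g\<in>X0. g x = g y" for i x y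
    using wN that by simp
  have cmb: "comb (?T i) ?K (\<lambda>x. w i x * N i x)" if "i \<in> J" for i using wN that by simp
  have T_sign: "\<bar>t x\<bar> \<le> 1" if i: "i \<in> J" and t: "t \<in> ?T i" for i t x
  proof -
    obtain Y where Y: "Y \<subseteq> X0 \<union> B i" "t = \<Prod>Y" using t by auto
    have "(\<Prod>Y) x = 1 \<or> (\<Prod>Y) x = -1" using Y(1) by (intro Prod_sign sgn[OF i]) auto
    then show ?thesis using Y(2) by auto
  qed
  have finJ: "finite J" using J(2) card_ge_0_finite by blast
  define k where "k = real (card J)"
  have k: "1 \<le> k" using J(2) by (simp add: k_def Suc_le_eq)
  define Z where "Z x = (\<Sum>i\<in>J. w i x * N i x)" for x
  have ZZ: "(\<Sum>x\<in>cube m. (Z x)\<^sup>2) \<le> (k * ?K\<^sup>2 + k\<^sup>2 * (?K\<^sup>2 * \<epsilon>)) * 2 ^ m"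
  proof -
    have pair: "(\<Sum>x\<in>cube m. (w i x * N i x) * (w j x * N j x)) \<le>
        (if i = j then ?K\<^sup>2 * 2 ^ m else 0) + ?K\<^sup>2 * \<epsilon> * 2 ^ m" if i: "i \<in> J" and j: "j \<in> J" for i j
    proof (cases "i = j")
      case True
      have "\<bar>w i x * N i x\<bar> \<le> ?K" for x by (rule comb_bound[OF cmb[OF i]]) (rule T_sign[OF i])
      then have "(w i x * N i x) * (w j x * N j x) \<le> ?K\<^sup>2" for x
        using True abs_le_square_iff[of "w i x * N i x" ?K] by (simp add: power2_eq_square)
      then have "(\<Sum>x\<in>cube m. (w i x * N i x) * (w j x * N j x)) \<le> (\<Sum>x\<in>cube m. ?K\<^sup>2)" by (intro sum_mono)
      also have "\<dots> = ?K\<^sup>2 * 2 ^ m" by (simp add: card_cube)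
      also have "\<dots> \<le> ?K\<^sup>2 * 2 ^ m + ?K\<^sup>2 * \<epsilon> * 2 ^ m" using \<epsilon> by simp
      finally show ?thesis using True by simp
    next
      case False
      have "comb {t * u |t u. t \<in> ?T i \<and> u \<in> ?T j} (?K * ?K) (\<lambda>x. (w i x * N i x) * (w j x * N j x))"
        by (rule comb_mult[OF cmb[OF i] cmb[OF j]]) blast
      then have "\<bar>\<Sum>x\<in>cube m. (w i x * N i x) * (w j x * N j x)\<bar> \<le> ?K * ?K * (\<epsilon> * 2 ^ m)"
      proof (rule comb_sum_bound)
        fix t assume "t \<in> {t * u |t u. t \<in> ?T i \<and> u \<in> ?T j}"
        then obtain Y Y' where Y: "Y \<subseteq> X0 \<union> B i" "\<not> Y \<subseteq> X0" "Y' \<subseteq> X0 \<union> B j" "\<not> Y' \<subseteq> X0" "t = \<Prod>Y * \<Prod>Y'"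
          by auto
        show "\<bar>\<Sum>x\<in>cube m. t x\<bar> \<le> \<epsilon> * 2 ^ m"
          unfolding Y(5) by (rule corr[OF i j False Y(1-4)])
      qed (use \<epsilon> in simp)
      then show ?thesis using False by (simp add: power2_eq_square mult_ac)
    qed
    have "(\<Sum>x\<in>cube m. (Z x)\<^sup>2) = (\<Sum>i\<in>J. \<Sum>j\<in>J. \<Sum>x\<in>cube m. (w i x * N i x) * (w j x * N j x))"
      unfolding Z_def power2_eq_square sum_product
      by (subst sum.swap) (intro sum.cong refl sum.swap)
    also have "\<dots> \<le> (\<Sum>i\<in>J. \<Sum>j\<in>J. (if i = j then ?K\<^sup>2 * 2 ^ m else 0) + ?K\<^sup>2 * \<epsilon> * 2 ^ m)"
      by (intro sum_mono pair)
    also have "\<dots> = (k * ?K\<^sup>2 + k\<^sup>2 * (?K\<^sup>2 * \<epsilon>)) * 2 ^ m"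
      using finJ by (simp add: sum.distrib sum.delta k_def power2_eq_square algebra_simps)
    finally show ?thesis .
  qed
  define W where "W x y = (\<Sum>i\<in>J. w i x * (of_bool (y i) - 1 / 3))" for x :: "nat \<Rightarrow> bool" and y :: "nat \<Rightarrow> bool"
  \<comment> \<open>Half of the signal \<open>k * (1 / (3 * 2 ^ d))^2\<close>, so that noise above
    \<open>- \<theta>\<close> cannot hide it.\<close>
  define \<theta> where "\<theta> = k / (18 * 4 ^ d)"
  have \<theta>: "0 < \<theta>" using k by (simp add: \<theta>_def)
  \<comment> \<open>An event must be a condition on y alone, so it asks for some x, that is, for
    some value of the core, at which the statistic is large.\<close>
  define A where "A = {y\<in>cube n. \<exists>x\<in>cube m. \<theta> \<le> W x y}"
  have Asub: "A \<subseteq> cube n" by (auto simp: A_def)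
  let ?y = "\<lambda>x i. i < n \<and> P i x"
  have in_A: "?y x \<in> A" if x: "x \<in> cube m" "- \<theta> < Z x" for x
  proof -
    have "W x (?y x) = (\<Sum>i\<in>J. (w i x)\<^sup>2 + w i x * N i x)"
      unfolding W_def
    proof (intro sum.cong refl)
      fix i assume i: "i \<in> J"
      then have "i < n" using J by auto
      then have "of_bool (i < n \<and> P i x) - 1 / 3 = w i x + N i x" using eq[OF i x(1)] by simp
      then show "w i x * (of_bool (i < n \<and> P i x) - 1 / 3) = (w i x)\<^sup>2 + w i x * N i x"
        by (simp only:) (simp add: algebra_simps power2_eq_square)
    qed
    then have "W x (?y x) = (\<Sum>i\<in>J. (w i x)\<^sup>2) + Z x" by (simp add: sum.distrib Z_def)
    moreover have "(\<Sum>i\<in>J. 1 / (9 * 4 ^ d)) \<le> (\<Sum>i\<in>J. (w i x)\<^sup>2)"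
    proof (rule sum_mono)
      fix i assume i: "i \<in> J"
      have "(1 / (3 * 2 ^ d))\<^sup>2 \<le> (w i x)\<^sup>2"
        using low[OF i, of x] by (simp add: abs_le_square_iff[symmetric])
      moreover have "(1 / (3 * 2 ^ d))\<^sup>2 = 1 / (9 * 4 ^ d :: real)"
        by (simp add: power2_eq_square power_mult_distrib[symmetric])
      ultimately show "1 / (9 * 4 ^ d) \<le> (w i x)\<^sup>2" by simp
    qed
    moreover have "(\<Sum>i\<in>J. 1 / (9 * 4 ^ d)) = 2 * \<theta>" by (simp add: \<theta>_def k_def)
    ultimately have "\<theta> \<le> W x (?y x)" using x(2) by linarith
    moreover have "?y x \<in> cube n" by (auto simp: cube_def)
    ultimately show ?thesis using x(1) by (auto simp: A_def)
  qed
  have PA: "1 - (k * ?K\<^sup>2 + k\<^sup>2 * (?K\<^sup>2 * \<epsilon>)) / \<theta>\<^sup>2 \<le> (\<Sum>y\<in>A. distP m n P y)"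
  proof -
    let ?bad = "{x\<in>cube m. ?y x \<notin> A}"
    have "real (card ?bad) * \<theta>\<^sup>2 = (\<Sum>x\<in>?bad. \<theta>\<^sup>2)" by simp
    also have "\<dots> \<le> (\<Sum>x\<in>?bad. (Z x)\<^sup>2)"
    proof (rule sum_mono)
      fix x assume "x \<in> ?bad"
      then have "Z x \<le> - \<theta>" using in_A[of x] by fastforce
      then have "\<bar>\<theta>\<bar> \<le> \<bar>Z x\<bar>" using \<theta> by linarith
      then show "\<theta>\<^sup>2 \<le> (Z x)\<^sup>2" by (simp only: abs_le_square_iff)
    qed
    also have "\<dots> \<le> (\<Sum>x\<in>cube m. (Z x)\<^sup>2)" by (intro sum_mono2) auto
    also note ZZ
    finally have "real (card ?bad) * \<theta>\<^sup>2 \<le> (k * ?K\<^sup>2 + k\<^sup>2 * (?K\<^sup>2 * \<epsilon>)) * 2 ^ m" .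
    moreover have "b / p \<le> R / q" if "b * q \<le> R * p" "0 < p" "0 < q" for b p R q :: real
      using that by (simp add: field_simps)
    ultimately have bad: "real (card ?bad) / 2 ^ m \<le> (k * ?K\<^sup>2 + k\<^sup>2 * (?K\<^sup>2 * \<epsilon>)) / \<theta>\<^sup>2"
      using \<theta> by simp
    have "card (cube m) = card ({x\<in>cube m. ?y x \<in> A} \<union> ?bad)" by (rule arg_cong[of _ _ card]) blast
    also have "\<dots> = card {x\<in>cube m. ?y x \<in> A} + card ?bad" by (rule card_Un_disjoint) auto
    finally have "real (card (cube m)) = real (card {x\<in>cube m. ?y x \<in> A}) + real (card ?bad)"
      by (simp only: of_nat_add)
    then have "real (card {x\<in>cube m. ?y x \<in> A}) = 2 ^ m - real (card ?bad)" by (simp add: card_cube)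
    then have "(\<Sum>y\<in>A. distP m n P y) = 1 - real (card ?bad) / 2 ^ m"
      by (simp add: distP_event[OF Asub] diff_divide_distrib)
    then show ?thesis using bad by simp
  qed
  have BA: "(\<Sum>y\<in>A. ber_prod n (1 / 3) y) \<le> 2 ^ d * (2 / 9 * (k * (2 ^ (d + 1))\<^sup>2) / \<theta>\<^sup>2)"
  proof -
    \<comment> \<open>Weights are set to 0 outside \<open>J\<close>, so that equal weights on
      \<open>J\<close> give equal vectors and the sign patterns on \<open>X0\<close> bound the
      number of vectors.\<close>
    define f where "f x = (\<lambda>i. if i \<in> J then w i x else 0)" for x
    define V where "V = f ` cube m"
    define S where "S v y = (\<Sum>i\<in>J. v i * (of_bool (y i) - 1 / 3))" for v :: "nat \<Rightarrow> real" and y :: "nat \<Rightarrow> bool"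
    have finV: "finite V" by (simp add: V_def)
    have Sf: "S (f x) y = W x y" for x y by (simp add: S_def W_def f_def)
    have "card V \<le> card (Pow X0)"
    proof -
      let ?pat = "\<lambda>x. {g\<in>X0. g x = 1}"
      have same: "f x = f y" if "?pat x = ?pat y" for x y
      proof -
        have "g x = g y" if g: "g \<in> X0" for g
        proof -
          obtain i where i: "i \<in> J" using J(2) by (metis card_gt_0_iff ex_in_conv)
          have "g \<in> ?pat x \<longleftrightarrow> g \<in> ?pat y" using \<open>?pat x = ?pat y\<close> by (rule arg_cong)
          then have "g x = 1 \<longleftrightarrow> g y = 1" using g by simp
          then show ?thesis using sgn[OF i UnI1[OF g], of x] sgn[OF i UnI1[OF g], of y] by metis
        qed
        then show ?thesis using dep by (simp add: f_def fun_eq_iff)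
      qed
      have "V \<subseteq> (\<lambda>Z. f (SOME x. ?pat x = Z)) ` Pow X0"
      proof
        fix v assume "v \<in> V"
        then obtain x where v: "v = f x" by (auto simp: V_def)
        have "?pat (SOME z. ?pat z = ?pat x) = ?pat x" by (rule someI[of _ x]) (rule refl)
        then have "v = f (SOME z. ?pat z = ?pat x)" unfolding v by (rule same[symmetric])
        then show "v \<in> (\<lambda>Z. f (SOME x. ?pat x = Z)) ` Pow X0" by (rule image_eqI) auto
      qed
      then show ?thesis using X0 by (meson card_image_le card_mono finite_Pow_iff finite_imageI le_trans)
    qed
    also have "\<dots> \<le> 2 ^ d"
    proof -
      obtain i where i: "i \<in> J" using J(2) by (metis card_gt_0_iff ex_in_conv)
      have "card X0 \<le> card (X0 \<union> B i)" using X0 B[OF i] by (intro card_mono) auto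
      then show ?thesis using d[OF i] X0 by (simp add: card_Pow)
    qed
    finally have cV: "real (card V) \<le> 2 ^ d" by (metis of_nat_le_iff of_nat_numeral of_nat_power)
    have "(\<Sum>y\<in>A. ber_prod n (1 / 3) y) \<le> (\<Sum>y\<in>A. \<Sum>v\<in>V. if \<theta> \<le> S v y then ber_prod n (1 / 3) y else 0)"
    proof (rule sum_mono)
      fix y assume "y \<in> A"
      then obtain x where x: "x \<in> cube m" "\<theta> \<le> W x y" by (auto simp: A_def)
      have "ber_prod n (1 / 3) y = (if \<theta> \<le> S (f x) y then ber_prod n (1 / 3) y else 0)"
        using x Sf by simp
      also have "\<dots> \<le> (\<Sum>v\<in>V. if \<theta> \<le> S v y then ber_prod n (1 / 3) y else 0)"
        using x finV by (intro member_le_sum) (auto simp: V_def ber_prod_nonneg)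
      finally show "ber_prod n (1 / 3) y \<le> (\<Sum>v\<in>V. if \<theta> \<le> S v y then ber_prod n (1 / 3) y else 0)" .
    qed
    also have "\<dots> \<le> (\<Sum>y\<in>cube n. \<Sum>v\<in>V. if \<theta> \<le> S v y then ber_prod n (1 / 3) y else 0)"
      using Asub by (intro sum_mono2) (auto intro!: sum_nonneg simp: ber_prod_nonneg)
    also have "\<dots> = (\<Sum>v\<in>V. \<Sum>y | y \<in> cube n \<and> \<theta> \<le> S v y. ber_prod n (1 / 3) y)"
      by (subst sum.swap) (simp add: sum.inter_filter)
    also have "\<dots> \<le> (\<Sum>v\<in>V. 2 / 9 * (k * (2 ^ (d + 1))\<^sup>2) / \<theta>\<^sup>2)"
    proof (rule sum_mono)
      fix v assume "v \<in> V"
      then have "\<bar>v i\<bar> \<le> 2 ^ (d + 1)" if "i \<in> J" for i using up[OF that] that by (auto simp: V_def f_def)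
      from ber_prod_tail[OF J(1) this, where p = "1 / 3" and \<theta> = \<theta>] \<theta>
      show "(\<Sum>y | y \<in> cube n \<and> \<theta> \<le> S v y. ber_prod n (1 / 3) y) \<le> 2 / 9 * (k * (2 ^ (d + 1))\<^sup>2) / \<theta>\<^sup>2"
        by (simp add: S_def k_def)
    qed
    also have "\<dots> = real (card V) * (2 / 9 * (k * (2 ^ (d + 1))\<^sup>2) / \<theta>\<^sup>2)" by simp
    also have "\<dots> \<le> 2 ^ d * (2 / 9 * (k * (2 ^ (d + 1))\<^sup>2) / \<theta>\<^sup>2)"
      using cV k by (intro mult_right_mono) auto
    finally show ?thesis .
  qed
  \<comment> \<open>The constants below are 1296 = 4 * 324 and 288 = 2/9 * 4 * 324, with 324 = 18^2
    from \<theta>; their sum stays below 2048 = 2^11.\<close>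
  have K2: "?K\<^sup>2 = 4 * 16 ^ d" "(2 ^ (d + 1) :: real)\<^sup>2 = 4 * 4 ^ d" "\<theta>\<^sup>2 = k\<^sup>2 / (324 * 16 ^ d)"
    by (simp_all add: \<theta>_def power_mult power_divide power_mult_distrib power2_eq_square
        flip: power_mult_distrib)
  have e1: "(k * ?K\<^sup>2 + k\<^sup>2 * (?K\<^sup>2 * \<epsilon>)) / \<theta>\<^sup>2 = 1296 * (16 ^ d * 16 ^ d) * (1 / k + \<epsilon>)"
    unfolding K2 using k by (simp add: field_simps power2_eq_square)
  have e2: "2 ^ d * (2 / 9 * (k * (2 ^ (d + 1))\<^sup>2) / \<theta>\<^sup>2) = 288 * (2 ^ d * 4 ^ d * 16 ^ d) * (1 / k)"
    unfolding K2 using k by (simp add: field_simps power2_eq_square)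
  have m1: "(16 ^ d * 16 ^ d :: real) = 256 ^ d" "(2 ^ d * 4 ^ d * 16 ^ d :: real) = 128 ^ d"
    by (simp_all flip: power_mult_distrib)
  have "(128 ^ d :: real) \<le> 256 ^ d" by (intro power_mono) auto
  then have "(288 * 128 ^ d) * (1 / k) \<le> (288 * 256 ^ d) * (1 / k)" using k by (intro mult_right_mono) auto
  moreover have "(288 * 256 ^ d) * (1 / k) \<le> (288 * 256 ^ d) * (1 / k + \<epsilon>)" using \<epsilon> by (intro mult_left_mono) auto
  moreover have "0 \<le> 256 ^ d * (1 / k + \<epsilon>)" using \<epsilon> k by simp
  moreover have "1296 * q * e + b \<le> 2048 * q * e" if "b \<le> c" "c \<le> 288 * q * e" "0 \<le> q * e" for b c q e :: real
  proof -
    have "2048 * q * e = 1296 * q * e + 288 * q * e + 464 * (q * e)" by (simp add: algebra_simps)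
    then show ?thesis using that by linarith
  qed
  ultimately have "1296 * 256 ^ d * (1 / k + \<epsilon>) + 288 * 128 ^ d * (1 / k) \<le> 2048 * 256 ^ d * (1 / k + \<epsilon>)"
    by blast
  moreover have "(2 :: real) ^ (11 + 8 * d) = 2048 * 256 ^ d" by (simp add: power_add power_mult)
  ultimately have "1296 * 256 ^ d * (1 / k + \<epsilon>) + 288 * 128 ^ d * (1 / k) \<le> 2 ^ (11 + 8 * d) * (1 / k + \<epsilon>)"
    by (simp only:)
  then have "1 - 2 ^ (11 + 8 * d) * (1 / k + \<epsilon>) \<le> (\<Sum>y\<in>A. distP m n P y) - (\<Sum>y\<in>A. ber_prod n (1 / 3) y)"
    using PA BA unfolding e1 e2 m1 by linarith
  also have "\<dots> \<le> tv_dist n (distP m n P) (ber_prod n (1 / 3))"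
    by (rule tv_dist_ge[OF Asub distP_total ber_prod_total])
  finally show ?thesis by (simp add: k_def)
qed

section \<open>Applying the elimination\<close>

lemma poly_deg_le_coordinate: "poly_deg_le m 2 (\<lambda>x. x j)"
proof (cases "j < m")
  case True
  have "{S. S = {j} \<and> (\<forall>i\<in>S. x i)} = (if x j then {{j}} else {})" for x :: "nat \<Rightarrow> bool" by auto
  then show ?thesis
    unfolding poly_deg_le_def using True by (intro exI[of _ "{{j}}"]) auto
next
  case False
  then show ?thesis
    unfolding poly_deg_le_def by (intro exI[of _ "{}"]) (auto simp: cube_def)
qed

text \<open>The minimum in \<open>rank2\<close> has to be shown to be attained: the coordinate
  functions determine any \<open>P\<close> on the cube.\<close>

lemma rank2_determined:
  assumes "rank2 m P \<le> r"
  shows "\<exists>K\<subseteq>quad m. finite K \<and> card K \<le> r \<and> determined m K P"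
proof -
  let ?R = "\<lambda>k. 0 < k \<and> (\<exists>(Q :: nat \<Rightarrow> (nat \<Rightarrow> bool) \<Rightarrow> bool) (\<Gamma> :: (nat \<Rightarrow> bool) \<Rightarrow> bool).
        (\<forall>j<k. poly_deg_le m 2 (Q j)) \<and>
        (\<forall>x\<in>cube m. P x = \<Gamma> (\<lambda>j. if j < k then Q j x else False)))"
  have "(\<lambda>j. if j < Suc m then x j else False) = x" if "x \<in> cube m" for x
    using that by (auto simp: cube_def fun_eq_iff less_Suc_eq_le)
  \<comment> \<open>\<open>Suc m\<close> and not m, because the number of quadratics must be
    positive even for \<open>m = 0\<close>.\<close>
  then have "?R (Suc m)"
    using poly_deg_le_coordinate by (intro conjI exI[of _ "\<lambda>j x. x j"] exI[of _ P]) simp_all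
  then have "?R (rank2 m P)" unfolding rank2_def by (rule LeastI)
  then obtain Q \<Gamma> where Q: "\<And>j. j < rank2 m P \<Longrightarrow> poly_deg_le m 2 (Q j)"
    and \<Gamma>: "\<And>x. x \<in> cube m \<Longrightarrow> P x = \<Gamma> (\<lambda>j. if j < rank2 m P then Q j x else False)" by blast
  let ?K = "(\<lambda>j. sgn_fun m (Q j)) ` {..<rank2 m P}"
  have "determined m ?K P"
    unfolding determined_def
  proof (intro ballI impI)
    fix x y assume xy: "x \<in> cube m" "y \<in> cube m" "\<forall>g\<in>?K. g x = g y"
    have "Q j x = Q j y" if "j < rank2 m P" for j
      using bspec[OF xy(3), of "sgn_fun m (Q j)"] that xy(1,2) by (simp add: sgn_fun_def split: if_splits)
    then have "(\<lambda>j. if j < rank2 m P then Q j x else False) = (\<lambda>j. if j < rank2 m P then Q j y else False)"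
      by auto
    then show "P x = P y" using \<Gamma> xy by simp
  qed
  moreover have "card ?K \<le> r" using card_image_le[of "{..<rank2 m P}"] assms by (metis card_lessThan finite_lessThan le_trans)
  ultimately show ?thesis using Q sgn_fun_quad by (intro exI[of _ ?K]) auto
qed

lemma filtered_quad: "filtered_group (quad m) (low_rank m)"
  by unfold_locales (auto intro: one_in_quad times_in_quad quad_square one_in_low_rank times_in_low_rank)

text \<open>With 1 as the only small element, \<open>clean\<close> is linear independence of the
  core together with any two private parts, and errors cannot accumulate.\<close>

lemma filtered_lin: "filtered_group (lin m) (\<lambda>_. {1})"
  by unfold_locales (auto intro: one_in_lin times_in_lin quad_square subsetD[OF lin_subset_quad])

lemma determinedD:
  "determined m X P \<Longrightarrow> x \<in> cube m \<Longrightarrow> y \<in> cube m \<Longrightarrow> (\<And>g. g \<in> X \<Longrightarrow> g x = g y) \<Longrightarrow> P x = P y"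
  unfolding determined_def by blast

lemma sp_apply_cong:
  fixes X :: "('x \<Rightarrow> real) set"
  assumes "u \<in> sp X" "\<And>g. g \<in> X \<Longrightarrow> g x = g y"
  shows "u x = u y"
proof -
  obtain Y where Y: "Y \<subseteq> X" "u = \<Prod>Y" using assms(1) by (auto simp: sp_def)
  show ?thesis unfolding Y(2) Prod_apply by (rule prod.cong) (use assms(2) Y(1) in auto)
qed

text \<open>Elimination starts with an empty core and private parts \<open>K i\<close>, whence the
  measure \<open>2 * r\<close>. The starting error \<sigma>0 is a free parameter that sets the first
  rank threshold \<open>a * \<sigma>0\<close>. At the end each of the at most r original generators
  contributes at most \<sigma> characters.\<close>

lemma quad_stage:
  assumes K: "\<And>i. i < n \<Longrightarrow> K i \<subseteq> quad m \<and> finite (K i) \<and> card (K i) \<le> r \<and> determined m (K i) (P i)"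
    and k: "0 < k" "k * (4 * k * 2 ^ r) ^ (2 * r) \<le> n"
  shows "\<exists>J C F \<Lambda> \<sigma>. J \<subseteq> {..<n} \<and> card J = k \<and> finite C \<and> C \<subseteq> quad m \<and>
    (\<forall>i\<in>J. finite (F i) \<and> F i \<subseteq> quad m \<and> card (F i) + card C \<le> r) \<and>
    (\<forall>i\<in>J. finite (\<Lambda> i) \<and> \<Lambda> i \<subseteq> lin m \<and> card (\<Lambda> i) \<le> r * \<sigma> \<and> determined m (C \<union> F i \<union> \<Lambda> i) (P i)) \<and>
    filtered_group.clean (low_rank m) C F J (a * \<sigma>) \<and> \<sigma>0 \<le> \<sigma> \<and> \<sigma> \<le> (a + 1) ^ (2 * r) * \<sigma>0"
proof -
  interpret Q: filtered_group "quad m" "low_rank m" by (rule filtered_quad)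
  have "\<exists>J C' F' \<sigma>'. J \<subseteq> {..<n} \<and> card J = k \<and> finite C' \<and> C' \<subseteq> quad m \<and>
    (\<forall>i\<in>J. finite (F' i) \<and> F' i \<subseteq> quad m \<and> card (F' i) + card C' \<le> r) \<and>
    Q.covers C' F' K \<sigma>' J \<and> Q.clean C' F' J (a * \<sigma>') \<and> \<sigma>0 \<le> \<sigma>' \<and> \<sigma>' \<le> (a + 1) ^ (2 * r) * \<sigma>0"
  proof (rule Q.elimination)
    show "Q.covers {} K K \<sigma>0 {..<n}"
      unfolding Q.covers_def
    proof (intro ballI)
      fix i h assume "h \<in> K i"
      then have "h \<in> sp ({} \<union> K i)" using sp_I[of "{h}" "{} \<union> K i"] by simp
      moreover have "h = 1 * h" by simp
      ultimately show "\<exists>e\<in>low_rank m \<sigma>0. \<exists>u\<in>sp ({} \<union> K i). h = e * u"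
        using one_in_low_rank by blast
    qed
  qed (use K k in simp_all)
  then obtain J C F \<sigma> where J: "J \<subseteq> {..<n}" "card J = k" "finite C" "C \<subseteq> quad m"
    and F: "\<forall>i\<in>J. finite (F i) \<and> F i \<subseteq> quad m \<and> card (F i) + card C \<le> r"
    and cov: "Q.covers C F K \<sigma> J" and cl: "Q.clean C F J (a * \<sigma>)"
    and \<sigma>: "\<sigma>0 \<le> \<sigma>" "\<sigma> \<le> (a + 1) ^ (2 * r) * \<sigma>0"
    by (elim exE conjE) (rule that)
  have "\<forall>i\<in>J. \<exists>\<Lambda>. finite \<Lambda> \<and> \<Lambda> \<subseteq> lin m \<and> card \<Lambda> \<le> r * \<sigma> \<and> determined m (C \<union> F i \<union> \<Lambda>) (P i)"
  proof
    fix i assume i: "i \<in> J"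
    then have Ki: "finite (K i)" "card (K i) \<le> r" "determined m (K i) (P i)" using K J(1) by auto
    have "\<forall>h\<in>K i. \<exists>L. L \<subseteq> lin m \<and> finite L \<and> card L \<le> \<sigma> \<and> determined m (C \<union> F i \<union> L) h"
    proof
      fix h assume hK: "h \<in> K i"
      obtain e u where e: "e \<in> low_rank m \<sigma>" and u: "u \<in> sp (C \<union> F i)" and h: "h = e * u"
        using bspec[OF bspec[OF cov[unfolded Q.covers_def] i] hK] by (elim bexE) (rule that)
      obtain L where L: "L \<subseteq> lin m" "finite L" "card L \<le> \<sigma>" "determined m L e"
      proof -
        have "\<exists>L\<subseteq>lin m. finite L \<and> card L \<le> \<sigma> \<and> determined m L e"
          using e unfolding low_rank_def mem_Collect_eq .
        then show ?thesis by (elim exE conjE) (rule that)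
      qed
      have "determined m (C \<union> F i \<union> L) h"
        unfolding determined_def
      proof (intro ballI impI)
        fix x y assume xy: "x \<in> cube m" "y \<in> cube m" "\<forall>g\<in>C \<union> F i \<union> L. g x = g y"
        have "e x = e y" by (rule determinedD[OF L(4) xy(1,2)]) (rule bspec[OF xy(3)], simp)
        moreover have "u x = u y" by (rule sp_apply_cong[OF u]) (rule bspec[OF xy(3)], simp)
        ultimately show "h x = h y" unfolding h times_fun_def by (rule arg_cong2)
      qed
      with L show "\<exists>L. L \<subseteq> lin m \<and> finite L \<and> card L \<le> \<sigma> \<and> determined m (C \<union> F i \<union> L) h"
        by (intro exI[of _ L] conjI)
    qed
    from bchoice[OF this] obtain L where
      L: "\<forall>h\<in>K i. L h \<subseteq> lin m \<and> finite (L h) \<and> card (L h) \<le> \<sigma> \<and> determined m (C \<union> F i \<union> L h) h"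
      by (elim exE) (rule that)
    let ?\<Lambda> = "\<Union>h\<in>K i. L h"
    have "card ?\<Lambda> \<le> (\<Sum>h\<in>K i. card (L h))" by (rule card_UN_le[OF Ki(1)])
    also have "\<dots> \<le> (\<Sum>h\<in>K i. \<sigma>)" using L by (intro sum_mono) auto
    also have "\<dots> \<le> r * \<sigma>" using Ki(2) by simp
    finally have card: "card ?\<Lambda> \<le> r * \<sigma>" .
    have "determined m (C \<union> F i \<union> ?\<Lambda>) (P i)"
      unfolding determined_def
    proof (intro ballI impI)
      fix x y assume xy: "x \<in> cube m" "y \<in> cube m" "\<forall>g\<in>C \<union> F i \<union> ?\<Lambda>. g x = g y"
      have "h x = h y" if h: "h \<in> K i" for h
      proof -
        have "determined m (C \<union> F i \<union> L h) h" using L h by simp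
        then show ?thesis
          by (rule determinedD[OF _ xy(1,2)]) (rule bspec[OF xy(3)], use h in auto)
      qed
      then show "P i x = P i y" by (rule determinedD[OF Ki(3) xy(1,2)])
    qed
    then show "\<exists>\<Lambda>. finite \<Lambda> \<and> \<Lambda> \<subseteq> lin m \<and> card \<Lambda> \<le> r * \<sigma> \<and> determined m (C \<union> F i \<union> \<Lambda>) (P i)"
      using card L Ki(1) by (intro exI[of _ ?\<Lambda>]) auto
  qed
  from bchoice[OF this] obtain \<Lambda> where
    "\<forall>i\<in>J. finite (\<Lambda> i) \<and> \<Lambda> i \<subseteq> lin m \<and> card (\<Lambda> i) \<le> r * \<sigma> \<and> determined m (C \<union> F i \<union> \<Lambda> i) (P i)"
    by (elim exE) (rule that)
  then show ?thesis using J F cl \<sigma>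
    by (intro exI[of _ J] exI[of _ C] exI[of _ F] exI[of _ \<Lambda>] exI[of _ \<sigma>] conjI)
qed

text \<open>\<open>elimination\<close> with \<open>a = 0\<close> and error 0 throughout: rewriting
  is exact, so the split-off characters are words in the new generators.\<close>

lemma lin_stage:
  assumes "finite I" and \<Lambda>: "\<And>i. i \<in> I \<Longrightarrow> finite (\<Lambda> i) \<and> \<Lambda> i \<subseteq> lin m \<and> card (\<Lambda> i) \<le> s"
    and k: "0 < k" "k * (4 * k * 2 ^ s) ^ (2 * s) \<le> card I"
  shows "\<exists>J C F. J \<subseteq> I \<and> card J = k \<and> finite C \<and> C \<subseteq> lin m \<and>
    (\<forall>i\<in>J. finite (F i) \<and> F i \<subseteq> lin m \<and> card (F i) + card C \<le> s) \<and>
    (\<forall>i\<in>J. \<Lambda> i \<subseteq> sp (C \<union> F i)) \<and> filtered_group.clean (\<lambda>_. {1}) C F J 0"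
proof -
  interpret L: filtered_group "lin m" "\<lambda>_. {1}" by (rule filtered_lin)
  have "\<exists>J C' F' \<sigma>'. J \<subseteq> I \<and> card J = k \<and> finite C' \<and> C' \<subseteq> lin m \<and>
    (\<forall>i\<in>J. finite (F' i) \<and> F' i \<subseteq> lin m \<and> card (F' i) + card C' \<le> s) \<and>
    L.covers C' F' \<Lambda> \<sigma>' J \<and> L.clean C' F' J (0 * \<sigma>') \<and> 0 \<le> \<sigma>' \<and> \<sigma>' \<le> (0 + 1) ^ (2 * s) * 0"
  proof (rule L.elimination)
    show "L.covers {} \<Lambda> \<Lambda> 0 I"
      unfolding L.covers_def
    proof (intro ballI)
      fix i h assume "h \<in> \<Lambda> i"
      then have "h \<in> sp ({} \<union> \<Lambda> i)" using sp_I[of "{h}" "{} \<union> \<Lambda> i"] by simp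
      then show "\<exists>e\<in>{1}. \<exists>u\<in>sp ({} \<union> \<Lambda> i). h = e * u" by auto
    qed
  qed (use assms in simp_all)
  then obtain J C F \<sigma> where J: "J \<subseteq> I" "card J = k" "finite C" "C \<subseteq> lin m"
    and F: "\<forall>i\<in>J. finite (F i) \<and> F i \<subseteq> lin m \<and> card (F i) + card C \<le> s"
    and cov: "L.covers C F \<Lambda> \<sigma> J" and cl: "L.clean C F J (0 * \<sigma>)"
    by (elim exE conjE) (rule that)
  have "\<Lambda> i \<subseteq> sp (C \<union> F i)" if "i \<in> J" for i
    using cov that unfolding L.covers_def by auto
  moreover have "L.clean C F J 0" using cl by simp
  ultimately show ?thesis using J F by (intro exI[of _ J] exI[of _ C] exI[of _ F] conjI ballI) auto
qed

lemma Prod_split: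
  assumes "finite Y" "Y \<subseteq> A \<union> B" "A \<inter> B = {}"
  shows "\<Prod>Y = \<Prod>(Y \<inter> A) * \<Prod>(Y \<inter> B :: 'v::comm_monoid_mult set)"
proof -
  have "Y = (Y \<inter> A) \<union> (Y \<inter> B)" using assms(2) by blast
  then have "\<Prod>Y = \<Prod>((Y \<inter> A) \<union> (Y \<inter> B))" by (rule arg_cong)
  also have "\<dots> = \<Prod>(Y \<inter> A) * \<Prod>(Y \<inter> B)"
    using assms by (intro prod.union_disjoint) auto
  finally show ?thesis .
qed

text \<open>The product separates into a quadratic word and a character. A nonempty quadratic word
  has high rank and hence small correlation with every character; an empty one forces
  \<open>Y\<close> to contain a private character, and then the remaining character is
  nontrivial.\<close>

lemma word_correlation:
  assumes fin: "finite Cq" "finite Cl" "finite Fi" "finite Fj" "finite Gi" "finite Gj"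
    and q: "Cq \<subseteq> quad m" "Fi \<subseteq> quad m" "Fj \<subseteq> quad m"
    and l: "Cl \<subseteq> lin m" "Gi \<subseteq> lin m" "Gj \<subseteq> lin m"
    and hq: "\<And>A B D. A \<subseteq> Cq \<Longrightarrow> B \<subseteq> Fi \<Longrightarrow> D \<subseteq> Fj \<Longrightarrow> A \<noteq> {} \<or> B \<noteq> {} \<or> D \<noteq> {} \<Longrightarrow>
       \<Prod>A * \<Prod>B * \<Prod>D \<notin> low_rank m (Suc t)"
    and hl: "\<And>A B D. A \<subseteq> Cl \<Longrightarrow> B \<subseteq> Gi \<Longrightarrow> D \<subseteq> Gj \<Longrightarrow> A \<noteq> {} \<or> B \<noteq> {} \<or> D \<noteq> {} \<Longrightarrow>
       \<Prod>A * \<Prod>B * \<Prod>D \<noteq> 1"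
    and Y: "Y \<subseteq> (Cq \<union> Cl) \<union> (Fi \<union> Gi)" "\<not> Y \<subseteq> Cq \<union> Cl"
    and Y': "Y' \<subseteq> (Cq \<union> Cl) \<union> (Fj \<union> Gj)"
  shows "(\<Sum>x\<in>cube m. (\<Prod>Y * \<Prod>Y') x)\<^sup>2 \<le> (2 ^ m)\<^sup>2 / 2 ^ t"
proof -
  interpret Q: filtered_group "quad m" "low_rank m" by (rule filtered_quad)
  interpret L: filtered_group "lin m" "\<lambda>_. {1}" by (rule filtered_lin)
  \<comment> \<open>A generator shared by the core and a private part would give a product of two
    nonempty words equal to 1.\<close>
  have dq1: "Cq \<inter> Fi = {}"
  proof (rule ccontr)
    assume "Cq \<inter> Fi \<noteq> {}"
    then obtain g where g: "g \<in> Cq" "g \<in> Fi" by auto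
    have "\<Prod>{g} * \<Prod>{g} * \<Prod>{} = 1" using g q Q.G_square[of g] by auto
    then show False using hq[of "{g}" "{g}" "{}"] g one_in_low_rank by simp
  qed
  have dq2: "Cq \<inter> Fj = {}"
  proof (rule ccontr)
    assume "Cq \<inter> Fj \<noteq> {}"
    then obtain g where g: "g \<in> Cq" "g \<in> Fj" by auto
    have "\<Prod>{g} * \<Prod>{} * \<Prod>{g} = 1" using g q Q.G_square[of g] by auto
    then show False using hq[of "{g}" "{}" "{g}"] g one_in_low_rank by simp
  qed
  have dl1: "Cl \<inter> Gi = {}"
  proof (rule ccontr)
    assume "Cl \<inter> Gi \<noteq> {}"
    then obtain g where g: "g \<in> Cl" "g \<in> Gi" by auto
    have "\<Prod>{g} * \<Prod>{g} * \<Prod>{} = 1" using g l L.G_square[of g] by auto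
    then show False using hl[of "{g}" "{g}" "{}"] g by simp
  qed
  have dl2: "Cl \<inter> Gj = {}"
  proof (rule ccontr)
    assume "Cl \<inter> Gj \<noteq> {}"
    then obtain g where g: "g \<in> Cl" "g \<in> Gj" by auto
    have "\<Prod>{g} * \<Prod>{} * \<Prod>{g} = 1" using g l L.G_square[of g] by auto
    then show False using hl[of "{g}" "{}" "{g}"] g by simp
  qed
  \<comment> \<open>A character has rank at most 1, so no quadratic generator is one; quadratic and
    linear generators are thus disjoint and the splitting of \<open>Y\<close> is
    unambiguous.\<close>
  have nl: "g \<notin> lin m" if g: "g \<in> Cq \<union> Fi \<union> Fj" for g
  proof
    assume "g \<in> lin m"
    then have lr: "g \<in> low_rank m (Suc t)" by (rule lin_in_low_rank) simp
    from g consider "g \<in> Cq" | "g \<in> Fi" | "g \<in> Fj" by blast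
    then show False
    proof cases
      case 1 then show False using hq[of "{g}" "{}" "{}"] lr by simp
    next
      case 2 then show False using hq[of "{}" "{g}" "{}"] lr by simp
    next
      case 3 then show False using hq[of "{}" "{}" "{g}"] lr by simp
    qed
  qed
  have mixed: "(Cq \<union> Fi) \<inter> (Cl \<union> Gi) = {}" "(Cq \<union> Fj) \<inter> (Cl \<union> Gj) = {}"
    using nl l by blast+
  have finY: "finite Y" by (rule finite_subset[OF Y(1)]) (use fin in simp)
  have finY': "finite Y'" by (rule finite_subset[OF Y']) (use fin in simp)
  have splitY: "\<Prod>Y = (\<Prod>(Y \<inter> Cq) * \<Prod>(Y \<inter> Fi)) * (\<Prod>(Y \<inter> Cl) * \<Prod>(Y \<inter> Gi))"
  proof -
    have "\<Prod>Y = \<Prod>(Y \<inter> (Cq \<union> Fi)) * \<Prod>(Y \<inter> (Cl \<union> Gi))"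
      by (rule Prod_split[OF finY _ mixed(1)]) (use Y(1) in blast)
    also have "\<Prod>(Y \<inter> (Cq \<union> Fi)) = \<Prod>(Y \<inter> (Cq \<union> Fi) \<inter> Cq) * \<Prod>(Y \<inter> (Cq \<union> Fi) \<inter> Fi)"
      by (rule Prod_split[OF _ _ dq1]) (use finY in auto)
    also have "\<Prod>(Y \<inter> (Cl \<union> Gi)) = \<Prod>(Y \<inter> (Cl \<union> Gi) \<inter> Cl) * \<Prod>(Y \<inter> (Cl \<union> Gi) \<inter> Gi)"
      by (rule Prod_split[OF _ _ dl1]) (use finY in auto)
    finally show ?thesis by (simp only: Int_assoc Int_absorb1[OF Un_upper1] Int_absorb1[OF Un_upper2])
  qed
  have splitY': "\<Prod>Y' = (\<Prod>(Y' \<inter> Cq) * \<Prod>(Y' \<inter> Fj)) * (\<Prod>(Y' \<inter> Cl) * \<Prod>(Y' \<inter> Gj))"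
  proof -
    have "\<Prod>Y' = \<Prod>(Y' \<inter> (Cq \<union> Fj)) * \<Prod>(Y' \<inter> (Cl \<union> Gj))"
      by (rule Prod_split[OF finY' _ mixed(2)]) (use Y' in blast)
    also have "\<Prod>(Y' \<inter> (Cq \<union> Fj)) = \<Prod>(Y' \<inter> (Cq \<union> Fj) \<inter> Cq) * \<Prod>(Y' \<inter> (Cq \<union> Fj) \<inter> Fj)"
      by (rule Prod_split[OF _ _ dq2]) (use finY' in auto)
    also have "\<Prod>(Y' \<inter> (Cl \<union> Gj)) = \<Prod>(Y' \<inter> (Cl \<union> Gj) \<inter> Cl) * \<Prod>(Y' \<inter> (Cl \<union> Gj) \<inter> Gj)"
      by (rule Prod_split[OF _ _ dl2]) (use finY' in auto)
    finally show ?thesis by (simp only: Int_assoc Int_absorb1[OF Un_upper1] Int_absorb1[OF Un_upper2])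
  qed
  \<comment> \<open>Core factors of \<open>Y\<close> and \<open>Y'\<close> may cancel against each
    other; only their symmetric difference is left.\<close>
  define A where "A = (Y \<inter> Cq - Y' \<inter> Cq) \<union> (Y' \<inter> Cq - Y \<inter> Cq)"
  define A' where "A' = (Y \<inter> Cl - Y' \<inter> Cl) \<union> (Y' \<inter> Cl - Y \<inter> Cl)"
  have A: "\<Prod>(Y \<inter> Cq) * \<Prod>(Y' \<inter> Cq) = \<Prod>A"
    unfolding A_def by (rule prod_sym_diff) (use finY finY' q Q.G_square in auto)
  have A': "\<Prod>(Y \<inter> Cl) * \<Prod>(Y' \<inter> Cl) = \<Prod>A'"
    unfolding A'_def by (rule prod_sym_diff) (use finY finY' l L.G_square in auto)
  let ?g = "\<Prod>A * \<Prod>(Y \<inter> Fi) * \<Prod>(Y' \<inter> Fj)" and ?l = "\<Prod>A' * \<Prod>(Y \<inter> Gi) * \<Prod>(Y' \<inter> Gj)"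
  have eq: "\<Prod>Y * \<Prod>Y' = ?g * ?l"
    unfolding splitY splitY' A[symmetric] A'[symmetric] by (simp only: mult_ac)
  have sub: "A \<subseteq> Cq" "A' \<subseteq> Cl" by (auto simp: A_def A'_def)
  have g: "?g \<in> quad m"
    by (intro Q.G_mult Q.Prod_in_G) (use q sub in auto)
  have l': "?l \<in> lin m"
    by (intro L.G_mult L.Prod_in_G) (use l sub in auto)
  show ?thesis
  proof (cases "A \<noteq> {} \<or> Y \<inter> Fi \<noteq> {} \<or> Y' \<inter> Fj \<noteq> {}")
    case True
    have "?g \<notin> low_rank m (Suc t)" by (rule hq[OF sub(1) _ _ True]) auto
    from high_rank_bias[OF g l' this] show ?thesis unfolding eq .
  next
    case False
    then have g1: "?g = 1" by simp
    have "Y \<inter> Gi \<noteq> {}" using Y False by blast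
    then have "?l \<noteq> 1" by (intro hl[OF sub(2)]) auto
    then have "(\<Sum>x\<in>cube m. ?l x) = 0" by (rule lin_sum_eq_0[OF l'])
    then show ?thesis unfolding eq g1 mult_1_left by simp
  qed
qed

section \<open>Exponent bookkeeping for the two elimination stages\<close>

lemma size_bound_lin:
  assumes "r * \<sigma> \<le> (D :: nat)" "1 \<le> D"
  shows "2 ^ (50 * D) * (4 * 2 ^ (50 * D) * 2 ^ (r * \<sigma>)) ^ (2 * (r * \<sigma>)) \<le> (2 :: nat) ^ (156 * D\<^sup>2)"
proof -
  have "(4 * 2 ^ (50 * D) * 2 ^ (r * \<sigma>) :: nat) = 2 ^ (2 + 50 * D + r * \<sigma>)" by (simp add: power_add)
  then have "2 ^ (50 * D) * (4 * 2 ^ (50 * D) * 2 ^ (r * \<sigma>)) ^ (2 * (r * \<sigma>)) =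
      (2 :: nat) ^ (50 * D + (2 + 50 * D + r * \<sigma>) * (2 * (r * \<sigma>)))"
    by (simp only: power_add power_mult)
  also have "\<dots> \<le> 2 ^ (156 * D\<^sup>2)"
  proof (rule power_increasing)
    \<comment> \<open>156 = 50 + 4 + 102, after using \<open>r * \<sigma> \<le> D\<close> and
      \<open>D \<le> D^2\<close>.\<close>
    have "(2 + 50 * D + r * \<sigma>) * (2 * (r * \<sigma>)) \<le> (2 + 50 * D + D) * (2 * D)"
      using assms by (intro mult_le_mono add_le_mono) auto
    moreover have "D \<le> D\<^sup>2" using assms(2) by (simp add: power2_eq_square)
    moreover have "(2 + 50 * D + D) * (2 * D) = 4 * D + 102 * D\<^sup>2" by (simp add: power2_eq_square algebra_simps)
    ultimately show "50 * D + (2 + 50 * D + r * \<sigma>) * (2 * (r * \<sigma>)) \<le> 156 * D\<^sup>2" by linarith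
  qed simp
  finally show ?thesis .
qed

lemma size_bound_quad:
  assumes "r \<le> D" "1 \<le> r"
  shows "2 ^ (156 * D\<^sup>2) * (4 * 2 ^ (156 * D\<^sup>2) * 2 ^ r) ^ (2 * r) \<le> (2 :: nat) ^ (474 * r * D\<^sup>2)"
proof -
  have "(4 * 2 ^ (156 * D\<^sup>2) * 2 ^ r :: nat) = 2 ^ (2 + 156 * D\<^sup>2 + r)" by (simp add: power_add)
  then have "2 ^ (156 * D\<^sup>2) * (4 * 2 ^ (156 * D\<^sup>2) * 2 ^ r) ^ (2 * r) =
      (2 :: nat) ^ (156 * D\<^sup>2 + (2 + 156 * D\<^sup>2 + r) * (2 * r))"
    by (simp only: power_add power_mult)
  also have "\<dots> \<le> 2 ^ (474 * r * D\<^sup>2)"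
  proof (rule power_increasing)
    \<comment> \<open>474 = 156 + 4 + 312 + 2, each term being bounded by a multiple of
      \<open>r * D^2\<close>.\<close>
    have D1: "1 \<le> D" using assms by linarith
    have "r * 1 \<le> r * D\<^sup>2" using D1 by (intro mult_le_mono2) simp
    moreover have "r * r \<le> r * D\<^sup>2"
      using assms(1) D1 by (intro mult_le_mono2) (meson le_trans one_le_numeral self_le_power pos2 power2_nat_le_imp_le)
    moreover have "1 * D\<^sup>2 \<le> r * D\<^sup>2" using assms(2) by (intro mult_le_mono1)
    moreover have "(2 + 156 * D\<^sup>2 + r) * (2 * r) = 4 * r + 312 * (r * D\<^sup>2) + 2 * (r * r)" by (simp add: algebra_simps)
    moreover have "474 * r * D\<^sup>2 = 474 * (r * D\<^sup>2)" by simp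
    ultimately show "156 * D\<^sup>2 + (2 + 156 * D\<^sup>2 + r) * (2 * r) \<le> 474 * r * D\<^sup>2" by linarith
  qed simp
  finally show ?thesis .
qed

text \<open>The factor 100 comes from the final balance: the threshold
  \<open>100 * r * \<sigma>\<close> gives correlations near \<open>2 ^ (- 50 * s)\<close> with
  \<open>s = r * \<sigma>\<close>, while the statistic loses at most
  \<open>2 ^ (11 + 16 * s)\<close>. The final \<sigma> is not known in advance, so the index counts
  are fixed through the bound \<open>D\<close> on s.\<close>

theorem tv_dist_low_rank:
  fixes r \<sigma>0 n m :: nat and P :: "nat \<Rightarrow> (nat \<Rightarrow> bool) \<Rightarrow> bool"
  defines "D \<equiv> r * (100 * r + 1) ^ (2 * r) * \<sigma>0"
  assumes r: "1 \<le> r" and \<sigma>0: "1 \<le> \<sigma>0" and rk: "\<And>i. i < n \<Longrightarrow> rank2 m (P i) \<le> r"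
    and big: "2 ^ (474 * r * D\<^sup>2) \<le> n"
  shows "1 - 1 / 2 ^ \<sigma>0 \<le> tv_dist n (distP m n P) (ber_prod n (1 / 3))"
proof -
  have "1 * 1 \<le> (100 * r + 1) ^ (2 * r) * \<sigma>0" using \<sigma>0 by (intro mult_le_mono) simp_all
  then have rD: "r \<le> D" unfolding D_def by (simp add: mult.assoc)
  then have D1: "1 \<le> D" using r by linarith
  \<comment> \<open>Chosen backwards: \<open>?k2\<close> indices make \<open>1 / card J\<close> as
    small as the correlations, and \<open>?k1\<close> indices are enough for the linear stage to
    leave \<open>?k2\<close>.\<close>
  let ?k1 = "2 ^ (156 * D\<^sup>2) :: nat" and ?k2 = "2 ^ (50 * D) :: nat"
  have "\<forall>i\<in>{..<n}. \<exists>K. K \<subseteq> quad m \<and> finite K \<and> card K \<le> r \<and> determined m K (P i)"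
    using rank2_determined rk by simp
  from bchoice[OF this] obtain K where
    K: "\<forall>i\<in>{..<n}. K i \<subseteq> quad m \<and> finite (K i) \<and> card (K i) \<le> r \<and> determined m (K i) (P i)"
    by (elim exE) (rule that)
  have "?k1 * (4 * ?k1 * 2 ^ r) ^ (2 * r) \<le> n" using size_bound_quad[OF rD r] big by (rule le_trans)
  then have "\<exists>J C F \<Lambda> \<sigma>. J \<subseteq> {..<n} \<and> card J = ?k1 \<and> finite C \<and> C \<subseteq> quad m \<and>
    (\<forall>i\<in>J. finite (F i) \<and> F i \<subseteq> quad m \<and> card (F i) + card C \<le> r) \<and>
    (\<forall>i\<in>J. finite (\<Lambda> i) \<and> \<Lambda> i \<subseteq> lin m \<and> card (\<Lambda> i) \<le> r * \<sigma> \<and> determined m (C \<union> F i \<union> \<Lambda> i) (P i)) \<and>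
    filtered_group.clean (low_rank m) C F J (100 * r * \<sigma>) \<and> \<sigma>0 \<le> \<sigma> \<and> \<sigma> \<le> (100 * r + 1) ^ (2 * r) * \<sigma>0"
    using K by (intro quad_stage[where K = K]) auto
  then obtain J1 Cq Fq \<Lambda> \<sigma> where J1: "J1 \<subseteq> {..<n}" "card J1 = ?k1" and Cq: "finite Cq" "Cq \<subseteq> quad m"
    and Fq: "\<forall>i\<in>J1. finite (Fq i) \<and> Fq i \<subseteq> quad m \<and> card (Fq i) + card Cq \<le> r"
    and \<Lambda>: "\<forall>i\<in>J1. finite (\<Lambda> i) \<and> \<Lambda> i \<subseteq> lin m \<and> card (\<Lambda> i) \<le> r * \<sigma> \<and> determined m (Cq \<union> Fq i \<union> \<Lambda> i) (P i)"
    and cq: "filtered_group.clean (low_rank m) Cq Fq J1 (100 * r * \<sigma>)"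
    and \<sigma>: "\<sigma>0 \<le> \<sigma>" "\<sigma> \<le> (100 * r + 1) ^ (2 * r) * \<sigma>0"
    by (elim exE conjE) (rule that)
  have r\<sigma>: "r * \<sigma> \<le> D" using \<sigma>(2) unfolding D_def mult.assoc by (rule mult_le_mono2)
  have \<sigma>1: "1 \<le> \<sigma>" using \<sigma> \<sigma>0 by linarith
  have "?k2 * (4 * ?k2 * 2 ^ (r * \<sigma>)) ^ (2 * (r * \<sigma>)) \<le> card J1" unfolding J1(2) by (rule size_bound_lin[OF r\<sigma> D1])
  moreover have "finite J1" using J1(1) finite_subset by blast
  ultimately have "\<exists>J C F. J \<subseteq> J1 \<and> card J = ?k2 \<and> finite C \<and> C \<subseteq> lin m \<and>
    (\<forall>i\<in>J. finite (F i) \<and> F i \<subseteq> lin m \<and> card (F i) + card C \<le> r * \<sigma>) \<and>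
    (\<forall>i\<in>J. \<Lambda> i \<subseteq> sp (C \<union> F i)) \<and> filtered_group.clean (\<lambda>_. {1}) C F J 0"
    using \<Lambda> by (intro lin_stage) simp_all
  then obtain J Cl Fl where J: "J \<subseteq> J1" "card J = ?k2" and Cl: "finite Cl" "Cl \<subseteq> lin m"
    and Fl: "\<forall>i\<in>J. finite (Fl i) \<and> Fl i \<subseteq> lin m \<and> card (Fl i) + card Cl \<le> r * \<sigma>"
    and sp: "\<forall>i\<in>J. \<Lambda> i \<subseteq> sp (Cl \<union> Fl i)" and cl: "filtered_group.clean (\<lambda>_. {1}) Cl Fl J 0"
    by (elim exE conjE) (rule that)
  let ?X0 = "Cq \<union> Cl" and ?B = "\<lambda>i. Fq i \<union> Fl i" and ?d = "r + r * \<sigma>" and ?\<epsilon> = "2 / 2 ^ (50 * r * \<sigma>) :: real"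
  interpret Q: filtered_group "quad m" "low_rank m" by (rule filtered_quad)
  interpret L: filtered_group "lin m" "\<lambda>_. {1}" by (rule filtered_lin)
  have FqJ: "finite (Fq i)" "Fq i \<subseteq> quad m" "card (Fq i) + card Cq \<le> r" if "i \<in> J" for i
    using Fq J(1) that by auto
  have FlJ: "finite (Fl i)" "Fl i \<subseteq> lin m" "card (Fl i) + card Cl \<le> r * \<sigma>" if "i \<in> J" for i
    using Fl that by auto
  have "1 \<le> r * \<sigma>" using r \<sigma>1 by simp
  then obtain t where t: "100 * r * \<sigma> = Suc t" using not0_implies_Suc[of "100 * r * \<sigma>"] by auto
  have main: "1 - 2 ^ (11 + 8 * ?d) * (1 / real (card J) + ?\<epsilon>) \<le> tv_dist n (distP m n P) (ber_prod n (1 / 3))"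
  proof (rule tv_dist_of_uncorrelated[where B = ?B and ?X0.0 = ?X0])
    show "J \<subseteq> {..<n}" using J J1 by blast
    show "0 < card J" using J by simp
    show "finite ?X0" using Cq Cl by simp
    show "0 \<le> ?\<epsilon>" by simp
  next
    fix i assume i: "i \<in> J"
    show "finite (?B i)" using FqJ FlJ i by simp
    have "card (?X0 \<union> ?B i) \<le> card ?X0 + card (?B i)" by (rule card_Un_le)
    also have "\<dots> \<le> (card Cq + card Cl) + (card (Fq i) + card (Fl i))" by (intro add_le_mono card_Un_le)
    finally show "card (?X0 \<union> ?B i) \<le> ?d" using FqJ(3)[OF i] FlJ(3)[OF i] by linarith
    show "determined m (?X0 \<union> ?B i) (P i)"
      unfolding determined_def
    proof (intro ballI impI)
      fix x y assume xy: "x \<in> cube m" "y \<in> cube m" "\<forall>g\<in>?X0 \<union> ?B i. g x = g y"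
      have det: "determined m (Cq \<union> Fq i \<union> \<Lambda> i) (P i)" using \<Lambda> J(1) i by blast
      show "P i x = P i y"
      proof (rule determinedD[OF det xy(1,2)])
        fix g assume "g \<in> Cq \<union> Fq i \<union> \<Lambda> i"
        then consider "g \<in> ?X0 \<union> ?B i" | "g \<in> sp (Cl \<union> Fl i)" using sp i by blast
        then show "g x = g y"
        proof cases
          case 1 then show ?thesis by (rule bspec[OF xy(3)])
        next
          case 2
          then show ?thesis by (rule sp_apply_cong) (rule bspec[OF xy(3)], auto)
        qed
      qed
    qed
  next
    fix g x i assume "i \<in> J" "g \<in> ?X0 \<union> ?B i"
    then have "g \<in> quad m" using FqJ(2) FlJ(2) Cq Cl lin_subset_quad by blast
    then show "g x = 1 \<or> g x = -1" by (rule quad_sign)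
  next
    fix i j Y Y' assume i: "i \<in> J" and j: "j \<in> J" and ij: "i \<noteq> j"
      and Y: "Y \<subseteq> ?X0 \<union> ?B i" "\<not> Y \<subseteq> ?X0" and Y': "Y' \<subseteq> ?X0 \<union> ?B j" "\<not> Y' \<subseteq> ?X0"
    have iJ1: "i \<in> J1" "j \<in> J1" using i j J(1) by auto
    have "(\<Sum>x\<in>cube m. (\<Prod>Y * \<Prod>Y') x)\<^sup>2 \<le> (2 ^ m)\<^sup>2 / 2 ^ t"
    proof (rule word_correlation[OF Cq(1) Cl(1) FqJ(1)[OF i] FqJ(1)[OF j] FlJ(1)[OF i] FlJ(1)[OF j]
          Cq(2) FqJ(2)[OF i] FqJ(2)[OF j] Cl(2) FlJ(2)[OF i] FlJ(2)[OF j] _ _ Y Y'(1)])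
      fix A B D assume "A \<subseteq> Cq" "B \<subseteq> Fq i" "D \<subseteq> Fq j" "A \<noteq> {} \<or> B \<noteq> {} \<or> D \<noteq> {}"
      then show "\<Prod>A * \<Prod>B * \<Prod>D \<notin> low_rank m (Suc t)"
        using cq[unfolded Q.clean_def, rule_format, OF iJ1 ij] unfolding t by simp
    next
      fix A B D assume "A \<subseteq> Cl" "B \<subseteq> Fl i" "D \<subseteq> Fl j" "A \<noteq> {} \<or> B \<noteq> {} \<or> D \<noteq> {}"
      then show "\<Prod>A * \<Prod>B * \<Prod>D \<noteq> 1"
        using cl[unfolded L.clean_def, rule_format, OF i j ij] by simp
    qed
    also have "\<dots> \<le> (?\<epsilon> * 2 ^ m)\<^sup>2"
    proof -
      \<comment> \<open>The 2 in the numerator of \<open>?\<epsilon>\<close> absorbs the off-by-one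
        in \<open>Suc t = 100 * r * \<sigma>\<close>.\<close>
      have "(2 ^ (50 * r * \<sigma>))\<^sup>2 = (2 :: real) ^ Suc t"
        unfolding t[symmetric] by (simp flip: power_mult add: mult_ac)
      then have "?\<epsilon>\<^sup>2 = 2 / 2 ^ t" by (simp add: power_divide)
      then have "(?\<epsilon> * 2 ^ m)\<^sup>2 = 2 / 2 ^ t * (2 ^ m)\<^sup>2" by (simp only: power_mult_distrib)
      then show ?thesis by (simp only:) (simp add: divide_right_mono)
    qed
    finally have "\<bar>\<Sum>x\<in>cube m. (\<Prod>Y * \<Prod>Y') x\<bar> \<le> \<bar>?\<epsilon> * 2 ^ m\<bar>" by (simp only: abs_le_square_iff)
    then show "\<bar>\<Sum>x\<in>cube m. (\<Prod>Y * \<Prod>Y') x\<bar> \<le> ?\<epsilon> * 2 ^ m" by simp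
  qed
  have "(2 :: real) ^ (11 + 8 * ?d) * (1 / real (card J) + ?\<epsilon>) \<le> 1 / 2 ^ \<sigma>0"
  proof -
    define s where "s = r * \<sigma>"
    have "r * 1 \<le> r * \<sigma>" using \<sigma>1 by (rule mult_le_mono2)
    moreover have "1 * \<sigma> \<le> r * \<sigma>" using r by (rule mult_le_mono1)
    ultimately have s1: "1 \<le> s" "r \<le> s" "\<sigma>0 \<le> s" using r \<sigma>(1) unfolding s_def by linarith+
    have "(2 :: real) ^ (50 * s) \<le> 2 ^ (50 * D)" using r\<sigma> by (intro power_increasing) (auto simp: s_def)
    then have "1 / real (card J) \<le> 1 / 2 ^ (50 * s)" unfolding J(2) by (simp add: frac_le)
    moreover have "?\<epsilon> = 2 * (1 / 2 ^ (50 * s))" by (simp add: s_def mult.assoc)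
    moreover have "(4 :: real) / 2 ^ (50 * s) = 4 * (1 / 2 ^ (50 * s))" "(0 :: real) \<le> 1 / 2 ^ (50 * s)" by simp_all
    ultimately have "1 / real (card J) + ?\<epsilon> \<le> 4 / 2 ^ (50 * s)" by linarith
    then have "(2 :: real) ^ (11 + 8 * ?d) * (1 / real (card J) + ?\<epsilon>) \<le> 2 ^ (11 + 16 * s) * (4 / 2 ^ (50 * s))"
      using s1 by (intro mult_mono power_increasing) (auto simp: s_def)
    also have "\<dots> = 2 ^ (13 + 16 * s) / 2 ^ (50 * s)" by (simp add: power_add)
    \<comment> \<open>\<open>13 + 16 * s \<le> 49 * s\<close> holds from \<open>s = 1\<close> on;
      one s is kept for the conclusion.\<close>
    also have "\<dots> \<le> 2 ^ (49 * s) / 2 ^ (50 * s)"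
      using s1 by (intro divide_right_mono power_increasing) auto
    also have "\<dots> = 1 / 2 ^ s"
    proof -
      have "50 * s = 49 * s + s" by simp
      then show ?thesis by (simp only: power_add) simp
    qed
    also have "\<dots> \<le> 1 / 2 ^ \<sigma>0" using s1 by (intro divide_left_mono power_increasing) auto
    finally show ?thesis .
  qed
  then show ?thesis using main by linarith
qed

section \<open>Choice of parameters\<close>

text \<open>Both sides equal 8 at \<open>x = 256\<close>; beyond it the tangent estimate for ln,
  with \<open>ln 2 \<ge> 1/2\<close>, is enough.\<close>

lemma log2_le_linear:
  assumes "256 \<le> x"
  shows "log 2 x \<le> x / 32"
proof -
  define z where "z = x / 256"
  have z: "1 \<le> z" "x = 2 ^ 8 * z" using assms by (simp_all add: z_def)
  have ln2: "1 / 2 \<le> ln (2 :: real)" using ln_le_minus_one[of "1 / 2 :: real"] by (simp add: ln_div)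
  have "log 2 (2 powr 8) = (8 :: real)" by (rule log_powr_cancel) auto
  then have "log 2 x = 8 + log 2 z" using z by (simp add: log_mult)
  also have "log 2 z = ln z / ln 2" by (simp add: log_def)
  also have "\<dots> \<le> (z - 1) / ln 2" using z ln_le_minus_one[of z] by (intro divide_right_mono) auto
  also have "\<dots> \<le> (z - 1) / (1 / 2)" using z ln2 by (intro divide_left_mono) auto
  finally show ?thesis using z by simp
qed

text \<open>The factor 1896 is \<open>4 * 474\<close>, the 4 coming from rounding up in the choice
  of \<sigma>0. All factors become powers of 2. The dominant exponent \<open>4 * x * log 2 x\<close>
  is at most \<open>x^2 / 8\<close>, and from 256 on the linear terms fit under
  \<open>3/4 * x^2\<close> as well.\<close>

lemma parameter_growth:
  fixes x :: real
  assumes x: "256 \<le> x"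
  shows "1896 * x ^ 3 * (101 * x) powr (4 * x) \<le> 2 powr (3 / 4 * x\<^sup>2)"
proof -
  define u where "u = log 2 x"
  have xu: "x = 2 powr u" using x by (simp add: u_def)
  have u: "u \<le> x / 32" unfolding u_def by (rule log2_le_linear[OF x])
  have "(1896 :: real) \<le> 2 powr 11" by simp
  moreover have "x ^ 3 = 2 powr (3 * u)"
    using x unfolding u_def by (simp add: powr_powr[symmetric] mult.commute[of 3])
  moreover have "(101 * x) powr (4 * x) \<le> 2 powr ((7 + u) * (4 * x))"
  proof -
    have "101 * x \<le> 2 powr 7 * 2 powr u" using x unfolding xu[symmetric] by simp
    then have "101 * x \<le> 2 powr (7 + u)" by (simp only: powr_add)
    then have "(101 * x) powr (4 * x) \<le> (2 powr (7 + u)) powr (4 * x)" using x by (intro powr_mono2) auto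
    then show ?thesis by (simp add: powr_powr)
  qed
  ultimately have "1896 * x ^ 3 * (101 * x) powr (4 * x) \<le> 2 powr 11 * 2 powr (3 * u) * 2 powr ((7 + u) * (4 * x))"
    by (intro mult_mono) auto
  also have "\<dots> = 2 powr (11 + 3 * u + (7 + u) * (4 * x))" by (simp add: powr_add)
  also have "\<dots> \<le> 2 powr (3 / 4 * x\<^sup>2)"
  proof (rule powr_mono)
    have "(7 + u) * (4 * x) \<le> (7 + x / 32) * (4 * x)" using u x by (intro mult_right_mono) auto
    moreover have "256 * x \<le> x * x" using x by (intro mult_right_mono) auto
    moreover have "(7 + x / 32) * (4 * x) = 28 * x + x * x / 8" by (simp add: algebra_simps)
    ultimately show "11 + 3 * u + (7 + u) * (4 * x) \<le> 3 / 4 * x\<^sup>2"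
      using u x unfolding power2_eq_square by linarith
  qed simp
  finally show ?thesis .
qed

text \<open>Reduces to \<open>2 ^ 11 \<le> (9/4) ^ 10\<close>. The value 9/4 is the inverse of 4/9,
  the upper bound for \<open>\<delta>^2\<close>.\<close>

lemma small_exponent: "2 powr (11 / 10) \<le> (9 / 4 :: real)"
proof -
  have "2 powr (11 / 10) = ((2::real) powr 11) powr (1 / 10)" by (simp only: powr_powr) simp
  also have "\<dots> \<le> ((9 / 4) powr 10) powr (1 / 10)"
  proof (intro powr_mono2)
    show "(2::real) powr 11 \<le> (9 / 4) powr 10" by (simp add: power_divide)
  qed auto
  also have "\<dots> = (9 / 4 :: real)" by (simp only: powr_powr) simp
  finally show ?thesis .
qed

text \<open>With \<open>L = 2 powr (x^2)\<close>, the choice \<open>L powr (1 / 8)\<close> for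
  \<sigma>0 costs \<open>L powr (1 / 4)\<close> after squaring and leaves
  \<open>L powr (3 / 4)\<close> for the factors depending on r, where \<open>r \<le> x\<close>
  applies.\<close>

lemma parameter_bound:
  fixes L :: real and r :: nat
  assumes L1: "1 < L" and lx: "256\<^sup>2 \<le> log 2 L" and r: "1 \<le> r" "real r \<le> sqrt (log 2 L)"
  shows "474 * real r * (real r * (100 * real r + 1) ^ (2 * r) * real (nat \<lceil>L powr (1 / 8)\<rceil>))\<^sup>2 \<le> L"
proof -
  define x where "x = sqrt (log 2 L)"
  have "0 \<le> log 2 L" using L1 by simp
  then have xx: "x\<^sup>2 = log 2 L" unfolding x_def by simp
  have x256: "256 \<le> x" using lx unfolding x_def by (intro real_le_rsqrt)
  have rx: "real r \<le> x" using r by (simp add: x_def)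
  have r1: "1 \<le> real r" using r by simp
  have Lx: "L = 2 powr (x\<^sup>2)" using xx L1 by simp
  let ?s = "real (nat \<lceil>L powr (1 / 8)\<rceil>)"
  have L8: "1 \<le> L powr (1 / 8)" using L1 by (intro ge_one_powr_ge_zero) auto
  then have s: "?s \<le> 2 * L powr (1 / 8)" by linarith
  have L8': "-1 < L powr (1 / 8)" using L8 by linarith
  have "474 * real r * (real r * (100 * real r + 1) ^ (2 * r) * ?s)\<^sup>2 =
      474 * real r ^ 3 * (100 * real r + 1) ^ (4 * r) * ?s\<^sup>2"
    by (simp add: power_mult_distrib power2_eq_square power3_eq_cube flip: power_mult power_add)
  also have "\<dots> \<le> 474 * x ^ 3 * (101 * x) powr (4 * x) * (2 * L powr (1 / 8))\<^sup>2"
  proof (intro mult_mono power_mono)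
    have "(100 * real r + 1) ^ (4 * r) = (100 * real r + 1) powr (4 * real r)"
      by (subst powr_realpow[symmetric]) auto
    also have "\<dots> \<le> (101 * x) powr (4 * real r)" using r1 rx by (intro powr_mono2) auto
    also have "\<dots> \<le> (101 * x) powr (4 * x)" using r1 rx by (intro powr_mono) auto
    finally show "(100 * real r + 1) ^ (4 * r) \<le> (101 * x) powr (4 * x)" .
  qed (use rx r1 s L8' in auto)
  also have "\<dots> = 1896 * x ^ 3 * (101 * x) powr (4 * x) * L powr (1 / 4)"
    using L1 by (simp add: power_mult_distrib power2_eq_square flip: powr_add)
  also have "\<dots> \<le> 2 powr (3 / 4 * x\<^sup>2) * L powr (1 / 4)"
    using parameter_growth[OF x256] by (intro mult_right_mono) auto
  also have "\<dots> = L" unfolding Lx by (simp add: powr_powr flip: powr_add)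
  finally show ?thesis .
qed

lemma tv_dist_nonneg: "0 \<le> tv_dist n D1 D2"
  by (simp add: tv_dist_def sum_nonneg)

lemma prob_one_bounds: "0 \<le> prob_one m f" "prob_one m f \<le> 1"
proof -
  have "card {x\<in>cube m. f x} \<le> card (cube m)" by (intro card_mono) auto
  then have "real (card {x\<in>cube m. f x}) \<le> real (2 ^ m)" unfolding card_cube by (simp only: of_nat_le_iff)
  then show "0 \<le> prob_one m f" "prob_one m f \<le> 1" by (simp_all add: prob_one_def)
qed

text \<open>For large n the low-rank bound gives an error of at most
  \<open>2 powr (- (L powr (1 / 8)))\<close>, and \<open>e \<le> 1/8\<close> follows from
  \<open>c \<le> 1/2\<close> and \<open>r \<ge> 2\<close>. For small n the choice of c together with
  \<open>\<delta> \<le> 2/3\<close> makes the right-hand side nonpositive.\<close>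

theorem theorem10p1:
  shows "\<exists>c::real. c > 0 \<and>
    (\<forall>(r::nat) (\<delta>::real) (n::nat) (m::nat) (P :: nat \<Rightarrow> (nat \<Rightarrow> bool) \<Rightarrow> bool).
       2 \<le> r \<longrightarrow> 0 < \<delta> \<longrightarrow> 2 \<le> n \<longrightarrow>
       real r \<le> sqrt (log 2 (log 2 (real n))) \<longrightarrow>
       (\<forall>i<n. poly_deg_le m 3 (P i) \<and> rank2 m (P i) \<le> r \<and>
              \<bar>prob_one m (P i) - 1/3\<bar> \<ge> \<delta>) \<longrightarrow>
       tv_dist n (distP m n P) (ber_prod n (1/3))
         \<ge> 1 - 2 powr (- ((log 2 (real n)) powr (c / (real r)^2))) / \<delta>^2)"
proof -
  obtain T :: real where T: "T = 256\<^sup>2" "0 < T" by simp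
  \<comment> \<open>The first term gives \<open>c / 4 \<le> 1 / 8\<close>; the second keeps
    \<open>L powr e\<close> at most 11/10 whenever \<open>log 2 L < T\<close>.\<close>
  define c :: real where "c = min (1 / 2) (4 * log 2 (11 / 10) / T)"
  have c: "0 < c" "c \<le> 1 / 2" "T * (c / 4) \<le> log 2 (11 / 10)"
    using T(2) by (simp_all add: c_def min_def field_simps)
  have "1 - 2 powr (- (log 2 (real n) powr (c / (real r)\<^sup>2))) / \<delta>\<^sup>2 \<le> tv_dist n (distP m n P) (ber_prod n (1 / 3))"
    if r: "2 \<le> r" and \<delta>: "0 < \<delta>" and n: "2 \<le> n" and rn: "real r \<le> sqrt (log 2 (log 2 (real n)))"
      and P: "\<forall>i<n. poly_deg_le m 3 (P i) \<and> rank2 m (P i) \<le> r \<and> \<bar>prob_one m (P i) - 1/3\<bar> \<ge> \<delta>"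
    for r \<delta> n m and P :: "nat \<Rightarrow> (nat \<Rightarrow> bool) \<Rightarrow> bool"
  proof -
    define L where "L = log 2 (real n)"
    define e where "e = c / (real r)\<^sup>2"
    have "0 < log 2 L"
    proof -
      have "0 < sqrt (log 2 L)" using r rn unfolding L_def by linarith
      then show ?thesis by simp
    qed
    moreover have "0 < L" using n by (simp add: L_def)
    ultimately have L1: "1 < L" by simp
    have n2: "real n = 2 powr L" using n by (simp add: L_def)
    have "\<bar>prob_one m (P 0) - 1/3\<bar> \<ge> \<delta>" using P n by simp
    \<comment> \<open>A probability differs from 1/3 by at most 2/3.\<close>
    then have \<delta>1: "\<delta> \<le> 2 / 3" using prob_one_bounds[of m "P 0"] by linarith
    have r4: "4 \<le> (real r)\<^sup>2"
    proof -
      have "(2::real)\<^sup>2 \<le> (real r)\<^sup>2" using r by (intro power_mono) auto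
      then show ?thesis by simp
    qed
    have e4: "e \<le> c / 4" unfolding e_def using r4 c r by (intro divide_left_mono) auto
    have \<delta>2: "\<delta>\<^sup>2 \<le> 4 / 9"
    proof -
      have "\<delta>\<^sup>2 \<le> (2 / 3)\<^sup>2" using \<delta> \<delta>1 by (intro power_mono) auto
      then show ?thesis by (simp add: power2_eq_square)
    qed
    have "1 - 2 powr (- (L powr e)) / \<delta>\<^sup>2 \<le> tv_dist n (distP m n P) (ber_prod n (1 / 3))"
    proof (cases "T \<le> log 2 L")
      case True
      define s where "s = nat \<lceil>L powr (1 / 8)\<rceil>"
      have L8: "L powr (1 / 8) \<le> real s" unfolding s_def by linarith
      have "0 < L powr (1 / 8)" using L1 by simp
      then have s1: "1 \<le> s" using L8 by linarith
      let ?D = "r * (100 * r + 1) ^ (2 * r) * s"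
      have "474 * real r * (real r * (100 * real r + 1) ^ (2 * r) * real s)\<^sup>2 \<le> L"
        unfolding s_def by (rule parameter_bound) (use L1 True T r rn in \<open>simp_all add: L_def\<close>)
      then have "real (474 * r * ?D\<^sup>2) \<le> L"
        by (simp only: of_nat_mult of_nat_power of_nat_add of_nat_numeral of_nat_1)
      then have "2 powr real (474 * r * ?D\<^sup>2) \<le> real n" unfolding n2 by (intro powr_mono) auto
      moreover have "2 powr real (474 * r * ?D\<^sup>2) = real (2 ^ (474 * r * ?D\<^sup>2))"
        by (subst powr_realpow) (simp_all only: of_nat_power of_nat_numeral zero_less_numeral)
      ultimately have big: "2 ^ (474 * r * ?D\<^sup>2) \<le> n" by (simp only: of_nat_le_iff)
      have "1 - 1 / 2 ^ s \<le> tv_dist n (distP m n P) (ber_prod n (1 / 3))"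
        by (rule tv_dist_low_rank[OF _ s1 _ big]) (use r P in auto)
      moreover have "1 / 2 ^ s \<le> 2 powr (- (L powr e)) / \<delta>\<^sup>2"
      proof -
        have "L powr e \<le> L powr (1 / 8)" using L1 e4 c by (intro powr_mono) auto
        then have "2 powr (- real s) \<le> 2 powr (- (L powr e))" using L8 by (intro powr_mono) auto
        then have "1 / 2 ^ s \<le> 2 powr (- (L powr e)) / 1" by (simp add: powr_minus_divide powr_realpow)
        also have "\<dots> \<le> 2 powr (- (L powr e)) / \<delta>\<^sup>2" using \<delta> \<delta>2 by (intro divide_left_mono) auto
        finally show ?thesis .
      qed
      ultimately show ?thesis by linarith
    next
      case False
      have "L powr e \<le> L powr (c / 4)" using L1 e4 by (intro powr_mono) auto
      also have "\<dots> \<le> (2 powr T) powr (c / 4)"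
      proof (rule powr_mono2)
        have "2 powr log 2 L \<le> 2 powr T" using False by (intro powr_mono) auto
        then show "L \<le> 2 powr T" using L1 by simp
      qed (use L1 c in auto)
      also have "\<dots> \<le> 2 powr log 2 (11 / 10)" unfolding powr_powr using c by (intro powr_mono) auto
      also have "\<dots> = 11 / 10" by simp
      finally have "2 powr (- (11 / 10)) \<le> 2 powr (- (L powr e))" by (intro powr_mono) auto
      moreover have "4 / 9 \<le> (2 powr (- (11 / 10)) :: real)"
        using small_exponent by (simp add: powr_minus_divide field_simps)
      ultimately have "\<delta>\<^sup>2 \<le> 2 powr (- (L powr e))" using \<delta>2 by linarith
      then have "1 \<le> 2 powr (- (L powr e)) / \<delta>\<^sup>2" using \<delta> by simp
      then show ?thesis using tv_dist_nonneg[of n "distP m n P" "ber_prod n (1 / 3)"] by linarith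
    qed
    then show ?thesis unfolding L_def e_def .
  qed
  then show ?thesis using c(1) by blast
qed

end
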